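(* Let $d\ge2$. For almost every $(\beta_2,\dots,\beta_d)\in[1,2]^{d-1}$ (with respect to Lebesgue measure) the following holds: with $Q(n)=n_1^2+\beta_2n_2^2+\cdots+\beta_dn_d^2$ for $n=(n_1,\dots,n_d)\in\mathbb{Z}^d$, for every $\epsilon>0$ there is a constant $C$ (independent of $N$) such that for all integers $N\ge1$, $$\Big\|\sup_{0<t<1}\Big|\sum_{n\in[-N,N]^d\cap\mathbb{Z}^d}e^{2\pi i(x\cdot n+tQ(n))}\Big|\Big\|_{L^2(\mathbb{T}^d,\,dx)}\le C\,N^{\frac{d+1}{2}+\epsilon}.$$
   Context: $\mathbb{T}^d=\mathbb{R}^d/\mathbb{Z}^d$. A property is called generic in $(\beta_2,\dots,\beta_d)$ if it holds outside a Lebesgue null set of parameters; the theorem asserts the estimate for generic parameters in this sense. *)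

theory Defs
  imports "HOL-Analysis.Analysis"
begin

text \<open>Points of \<open>\<real>\<^sup>d\<close> and \<open>\<int>\<^sup>d\<close> are functions on \<open>{1..d}\<close>, and parameters
  \<open>(\<beta>\<^sub>2, \<dots>, \<beta>\<^sub>d)\<close> are functions on \<open>{2..d}\<close>.\<close>

definition quad_form :: "nat \<Rightarrow> (nat \<Rightarrow> real) \<Rightarrow> (nat \<Rightarrow> int) \<Rightarrow> real" where
  "quad_form d \<beta> n = (of_int (n 1))\<^sup>2 + (\<Sum>i=2..d. \<beta> i * (of_int (n i))\<^sup>2)"

definition lattice_cube :: "nat \<Rightarrow> nat \<Rightarrow> (nat \<Rightarrow> int) set" where
  "lattice_cube d N = (\<Pi>\<^sub>E i\<in>{1..d}. {- int N..int N})"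

definition exp_sum :: "nat \<Rightarrow> (nat \<Rightarrow> real) \<Rightarrow> nat \<Rightarrow> (nat \<Rightarrow> real) \<Rightarrow> real \<Rightarrow> complex" where
  "exp_sum d \<beta> N x t =
     (\<Sum>n\<in>lattice_cube d N.
        exp (2 * of_real pi * \<i> *
          of_real ((\<Sum>i=1..d. x i * of_int (n i)) + t * quad_form d \<beta> n)))"

definition maximal_sum :: "nat \<Rightarrow> (nat \<Rightarrow> real) \<Rightarrow> nat \<Rightarrow> (nat \<Rightarrow> real) \<Rightarrow> real" where
  "maximal_sum d \<beta> N x = (SUP t\<in>{0<..<1}. cmod (exp_sum d \<beta> N x t))"

text \<open>The torus \<open>\<real>\<^sup>d/\<int>\<^sup>d\<close> with its Haar probability measure, realised as Lebesgue measure on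
  the fundamental domain \<open>[0,1)\<^sup>d\<close>.\<close>

definition torus :: "nat \<Rightarrow> (nat \<Rightarrow> real) measure" where
  "torus d = (\<Pi>\<^sub>M i\<in>{1..d}. restrict_space lborel {0..<1})"

text \<open>Meaningful only when \<open>F\<^sup>2\<close> is integrable; for \<open>maximal_sum\<close> this is
  \<open>integrable_maximal_sum_square\<close> below.\<close>

definition L2_norm_on :: "'a measure \<Rightarrow> ('a \<Rightarrow> real) \<Rightarrow> real" where
  "L2_norm_on M F = sqrt (LINT x|M. (F x)\<^sup>2)"

lemma cmod_exp_sum_le: "cmod (exp_sum d \<beta> N x t) \<le> real (card (lattice_cube d N))"
proof -
  have "cmod (exp_sum d \<beta> N x t) \<le> (\<Sum>n\<in>lattice_cube d N. 1)"
    unfolding exp_sum_def by (intro sum_norm_le) simp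
  then show ?thesis by simp
qed

lemma bdd_above_exp_sum: "bdd_above ((\<lambda>t. cmod (exp_sum d \<beta> N x t)) ` T)"
  by (intro bdd_aboveI2[where M = "real (card (lattice_cube d N))"] cmod_exp_sum_le)

lemma maximal_sum_nonneg: "0 \<le> maximal_sum d \<beta> N x"
  unfolding maximal_sum_def
  by (rule cSUP_upper2[where x = "1/2"]) (auto intro: bdd_above_exp_sum)

lemma maximal_sum_le: "maximal_sum d \<beta> N x \<le> real (card (lattice_cube d N))"
  unfolding maximal_sum_def by (rule cSUP_least) (auto intro: cmod_exp_sum_le)

lemma continuous_exp_sum: "continuous_on UNIV (exp_sum d \<beta> N x)"
  unfolding exp_sum_def by (intro continuous_intros)

lemma maximal_sum_rational:
  "maximal_sum d \<beta> N x = (SUP t\<in>{0<..<1} \<inter> \<rat>. cmod (exp_sum d \<beta> N x t))"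
proof -
  let ?g = "\<lambda>t. cmod (exp_sum d \<beta> N x t)"
  let ?S = "SUP t\<in>{0<..<1} \<inter> \<rat>. ?g t"
  have ne: "{0<..<1} \<inter> \<rat> \<noteq> ({} :: real set)"
    using Rats_dense_in_real[of 0 1] by auto
  have "?g t \<le> ?S" if t: "t \<in> {0<..<1}" for t
  proof (rule ccontr)
    assume "\<not> ?g t \<le> ?S"
    have "open {t. ?S < ?g t}"
      by (intro open_Collect_less continuous_intros continuous_exp_sum)
    then have "open ({t. ?S < ?g t} \<inter> {0<..<1})" by (intro open_Int) auto
    moreover have "t \<in> {t. ?S < ?g t} \<inter> {0<..<1}" using t \<open>\<not> ?g t \<le> ?S\<close> by auto
    ultimately obtain e where e: "e > 0" "ball t e \<subseteq> {t. ?S < ?g t} \<inter> {0<..<1}"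
      by (meson open_contains_ball)
    obtain q where q: "q \<in> \<rat>" "t < q" "q < t + e"
      using Rats_dense_in_real[of t "t + e"] e by auto
    then have "q \<in> ball t e" by (auto simp: dist_real_def)
    then have "?S < ?g q" "q \<in> {0<..<1} \<inter> \<rat>" using e q by auto
    moreover have "?g q \<le> ?S"
      using \<open>q \<in> {0<..<1} \<inter> \<rat>\<close> by (intro cSUP_upper bdd_above_exp_sum)
    ultimately show False by simp
  qed
  then have "maximal_sum d \<beta> N x \<le> ?S"
    unfolding maximal_sum_def by (intro cSUP_least) auto
  moreover have "?S \<le> maximal_sum d \<beta> N x"
    unfolding maximal_sum_def using ne by (intro cSUP_subset_mono bdd_above_exp_sum) auto
  ultimately show ?thesis by simp
qed

lemma borel_measurable_maximal_sum: "maximal_sum d \<beta> N \<in> borel_measurable (torus d)"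
proof -
  have coord: "(\<lambda>x. x i) \<in> borel_measurable (torus d)" if "i \<in> {1..d}" for i
  proof -
    have "(\<lambda>x. x i) \<in> measurable (torus d) (restrict_space lborel {0..<1})"
      unfolding torus_def using that by measurable
    moreover have "(\<lambda>y. y) \<in> borel_measurable (restrict_space lborel {0..<1::real})"
      by (intro measurable_restrict_space1) simp
    ultimately show ?thesis by (rule measurable_compose)
  qed
  have "(\<lambda>x. cmod (exp_sum d \<beta> N x t)) \<in> borel_measurable (torus d)" for t
  proof -
    have "(\<lambda>x. \<Sum>i=1..d. x i * real_of_int (n i)) \<in> borel_measurable (torus d)" for n
      by (intro borel_measurable_sum borel_measurable_times coord) auto
    note [measurable] = this
    show ?thesis unfolding exp_sum_def by measurable
  qed
  then have "(\<lambda>x. SUP t\<in>{0<..<1} \<inter> \<rat>. cmod (exp_sum d \<beta> N x t)) \<in> borel_measurable (torus d)"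
    by (intro borel_measurable_cSUP bdd_above_exp_sum countable_Int2 countable_rat) auto
  then show ?thesis unfolding maximal_sum_rational[abs_def] .
qed

lemma emeasure_torus: "emeasure (torus d) (space (torus d)) = 1"
proof -
  let ?I = "restrict_space lborel {0..<1::real}"
  have I1: "emeasure ?I (space ?I) = 1"
    by (simp add: emeasure_restrict_space space_restrict_space)
  interpret I: finite_measure ?I
    by (rule finite_measureI) (simp only: I1, simp)
  interpret product_sigma_finite "\<lambda>_::nat. ?I"
    by (intro product_sigma_finite.intro I.sigma_finite_measure_axioms)
  have "emeasure (torus d) (space (torus d)) = (\<Prod>i\<in>{1..d}. emeasure ?I (space ?I))"
    unfolding torus_def space_PiM by (rule emeasure_PiM) (simp_all only: finite_atLeastAtMost sets.top)
  then show ?thesis by (simp only: I1 prod.neutral_const)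
qed

lemma integrable_maximal_sum_square: "integrable (torus d) (\<lambda>x. (maximal_sum d \<beta> N x)\<^sup>2)"
proof -
  interpret finite_measure "torus d"
    by standard (simp add: emeasure_torus)
  show ?thesis
  proof (rule integrable_const_bound[where B = "(real (card (lattice_cube d N)))\<^sup>2"])
    show "AE x in torus d. norm ((maximal_sum d \<beta> N x)\<^sup>2) \<le> (real (card (lattice_cube d N)))\<^sup>2"
      by (simp add: power_mono maximal_sum_le maximal_sum_nonneg)
    show "(\<lambda>x. (maximal_sum d \<beta> N x)\<^sup>2) \<in> borel_measurable (torus d)"
      by (intro borel_measurable_power borel_measurable_maximal_sum)
  qed
qed

end

theory Submission
  imports Defs "HOL-Real_Asymp.Real_Asymp"
begin

text \<open>The sum factors as \<open>\<Prod>\<^sub>j S\<^sub>N(x\<^sub>j, \<beta>\<^sub>j t)\<close> with \<open>\<beta>\<^sub>1 = 1\<close> and \<open>S\<^sub>N\<close> the one-dimensional quadratic Weyl sum; let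
  \<open>2\<^sup>k\<close> be the dyadic scale with \<open>N \<le> 2\<^sup>k \<le> 2N\<close>.

  For \<open>t \<le> 3/2\<^sup>k\<close> a Sobolev bound in \<open>t\<close> and orthogonality in \<open>x\<close> suffice: the frequencies are
  \<open>O(N\<^sup>2)\<close> and the time interval has length \<open>O(1/N)\<close>, so the square of the maximal function has
  integral \<open>O(N\<^sup>d\<^sup>+\<^sup>1)\<close> for every \<open>\<beta>\<close>.

  For larger \<open>t\<close> the bound is uniform in \<open>x\<close>. By Weyl differencing and Dirichlet approximation,
  \<open>|S\<^sub>N(x, t)|\<^sup>2\<close> is, up to logarithms, at most \<open>4\<^sup>k/2\<^sup>i\<close> unless \<open>2t\<close> lies within \<open>2\<^sup>i/(q4\<^sup>k)\<close> of a
  fraction with denominator \<open>q < 2\<^sup>i\<close>. Up to constants, these neighbourhoods have density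
  \<open>4\<^sup>i/4\<^sup>k\<close> on \<open>[t, 2t]\<close>, and it suffices to test the \<open>4\<^sup>k\<close> times in \<open>4^(-k) \<int>\<close>. Hence the parameters for which, at
  some such time, the \<open>j\<close>-th factor reaches level \<open>i\<^sub>j\<close> for all \<open>j\<close> have measure
  \<open>O(4^(\<Sum> i\<^sub>j - k(d - 1)))\<close>. This is summable in \<open>k\<close> if \<open>\<Sum> i\<^sub>j \<le> k(d - 1 - \<eta>)\<close>, and otherwise the product
  of the bounds is at most \<open>2^(k(d + 1 + \<eta>))\<close> up to logarithms. Borel-Cantelli concludes.\<close>

section \<open>Weyl sums\<close>

definition int_dist :: "real \<Rightarrow> real" where
  "int_dist y = min (frac y) (1 - frac y)"

text \<open>Concavity of the sine on [0, pi] puts it above its chord from 0 to pi/2.\<close>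

lemma sin_pi_ge:
  assumes "0 \<le> u" "u \<le> 1/2"
  shows "2 * u \<le> sin (pi * u)"
proof -
  have "convex_on {0..pi} (\<lambda>x. - sin x)"
    by (rule f''_ge0_imp_convex[where f' = "\<lambda>x. - cos x" and f'' = sin])
       (auto intro!: derivative_eq_intros sin_ge_zero)
  then have "- sin ((1 - 2*u) *\<^sub>R 0 + (2*u) *\<^sub>R (pi/2)) \<le> (1 - 2*u) * (- sin 0) + (2*u) * (- sin (pi/2))"
    by (rule convex_onD) (use assms in auto)
  then show ?thesis by (simp add: mult.commute)
qed

text \<open>Both sides have period 1 and are symmetric under replacing y by 1 - y, so the chord
  bound on [0, 1/2] suffices.\<close>

lemma sin_pi_ge_int_dist: "2 * int_dist y \<le> \<bar>sin (pi * y)\<bar>"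
proof -
  define n where "n = \<lfloor>y\<rfloor>"
  have s0: "sin (pi * of_int n) = 0" by (simp add: sin_times_pi_eq_0 mult.commute[of pi])
  then have "(cos (pi * of_int n))\<^sup>2 = 1" using sin_cos_squared_add[of "pi * of_int n"] by simp
  then have c1: "\<bar>cos (pi * of_int n)\<bar> = 1" by (auto simp: power2_eq_1_iff)
  have "sin (pi * y) = sin (pi * frac y + pi * of_int n)"
    by (simp add: frac_def n_def algebra_simps)
  also have "\<bar>\<dots>\<bar> = \<bar>sin (pi * frac y)\<bar>"
    by (simp only: sin_add s0 abs_mult c1 mult_zero_right add_0_right mult_1_right)
  finally have 1: "\<bar>sin (pi * y)\<bar> = \<bar>sin (pi * frac y)\<bar>" .
  have 2: "\<bar>sin (pi * frac y)\<bar> = \<bar>sin (pi * (1 - frac y))\<bar>"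
    by (simp add: right_diff_distrib)
  have r: "0 \<le> frac y" "frac y < 1" by (auto simp: frac_lt_1)
  show ?thesis
  proof (cases "frac y \<le> 1/2")
    case True
    then show ?thesis using sin_pi_ge[of "frac y"] r 1 by (simp add: int_dist_def)
  next
    case False
    then show ?thesis using sin_pi_ge[of "1 - frac y"] r 1 2 by (simp add: int_dist_def)
  qed
qed

lemma norm_one_minus_cis: "cmod (1 - cis (2 * x)) = 2 * \<bar>sin x\<bar>"
proof -
  have "(cmod (1 - cis (2 * x)))\<^sup>2 = (2 * (sin x)\<^sup>2)\<^sup>2 + (2 * sin x * cos x)\<^sup>2"
    unfolding cmod_power2 by (simp add: cos_double_sin sin_double)
  also have "\<dots> = 4 * (sin x)\<^sup>2 * ((sin x)\<^sup>2 + (cos x)\<^sup>2)" by algebra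
  also have "\<dots> = (2 * \<bar>sin x\<bar>)\<^sup>2" by (simp add: power_mult_distrib)
  finally have "(cmod (1 - cis (2 * x)))\<^sup>2 = (2 * \<bar>sin x\<bar>)\<^sup>2" .
  then show ?thesis by (rule power2_eq_imp_eq) auto
qed

text \<open>By telescoping, \<open>1 - cis (2 * pi * y)\<close> times the sum has modulus at most 2,
  while this factor has modulus at least \<open>4 * int_dist y\<close>. The multiplied form stays
  valid at integers y, where the closed formula for the sum breaks down.\<close>

lemma geometric_cis_bound:
  "cmod (\<Sum>n\<in>{a..b}. cis (2 * pi * (of_int n * y))) * int_dist y \<le> 1/2"
proof -
  let ?w = "\<lambda>n::int. cis (2 * pi * (of_int n * y))"
  have tel: "(1 - cis (2 * pi * y)) * (\<Sum>n\<in>{a..a + int k - 1}. ?w n) = ?w a - ?w (a + int k)" for k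
  proof (induction k)
    case (Suc k)
    have "{a..a + int (Suc k) - 1} = insert (a + int k) {a..a + int k - 1}" by auto
    then have "(1 - cis (2 * pi * y)) * (\<Sum>n\<in>{a..a + int (Suc k) - 1}. ?w n)
        = (1 - cis (2 * pi * y)) * ?w (a + int k) + (?w a - ?w (a + int k))"
      using Suc.IH by (simp add: distrib_left)
    also have "\<dots> = ?w a - cis (2 * pi * y) * ?w (a + int k)" by (simp add: left_diff_distrib)
    also have "cis (2 * pi * y) * ?w (a + int k) = ?w (a + int (Suc k))"
      by (simp add: cis_mult algebra_simps)
    finally show ?case .
  qed simp
  show ?thesis
  proof (cases "a \<le> b")
    case True
    have "cmod (1 - cis (2 * (pi * y))) * cmod (\<Sum>n\<in>{a..b}. ?w n) = cmod (?w a - ?w (b + 1))"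
      using tel[of "nat (b + 1 - a)"] True by (simp flip: norm_mult add: mult.assoc)
    also have "\<dots> \<le> 2" using norm_triangle_ineq4[of "?w a" "?w (b + 1)"] by simp
    finally have "2 * \<bar>sin (pi * y)\<bar> * cmod (\<Sum>n\<in>{a..b}. ?w n) \<le> 2"
      unfolding norm_one_minus_cis .
    moreover have "2 * int_dist y * cmod (\<Sum>n\<in>{a..b}. ?w n) \<le> \<bar>sin (pi * y)\<bar> * cmod (\<Sum>n\<in>{a..b}. ?w n)"
      by (intro mult_right_mono sin_pi_ge_int_dist) simp
    ultimately show ?thesis by (simp add: mult_ac)
  qed simp
qed

section \<open>Quadratic Weyl sums: differencing and rational approximation\<close>

definition weyl_sum :: "nat \<Rightarrow> real \<Rightarrow> real \<Rightarrow> complex" where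
  "weyl_sum N x t = (\<Sum>n\<in>{- int N..int N}. cis (2 * pi * (x * of_int n + t * (of_int n)\<^sup>2)))"

text \<open>The squared modulus is a double sum over pairs (n, m). With h = n - m fixed, the
  quadratic terms in m cancel and a geometric sum with phase step \<open>h * (2 * t)\<close>
  remains; \<open>g h\<close> is its modulus. The point x enters only through a unimodular factor,
  which makes all later bounds uniform in x.\<close>

lemma weyl_differencing:
  obtains g :: "int \<Rightarrow> real"
  where "\<And>h. 0 \<le> g h" "\<And>h. g h \<le> 2 * real N + 1" "\<And>h. g h * int_dist (of_int h * (2 * t)) \<le> 1/2"
    "(cmod (weyl_sum N x t))\<^sup>2 \<le> (\<Sum>h\<in>{- 2 * int N..2 * int N}. g h)"
proof -
  define f where "f n = cis (2 * pi * (x * of_int n + t * (of_int n)\<^sup>2))" for n :: int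
  \<comment> \<open>These are the endpoints of the range of m for which both m and m + h lie in
    [-N, N].\<close>
  define l r where "l h = max (- int N) (- int N - h)" and "r h = min (int N) (int N - h)" for h
  define g where "g h = cmod (\<Sum>m\<in>{l h..r h}. cis (2 * pi * (of_int m * (of_int h * (2 * t)))))" for h
  have "of_real ((cmod (weyl_sum N x t))\<^sup>2) = weyl_sum N x t * cnj (weyl_sum N x t)"
    by (simp only: complex_norm_square)
  also have "\<dots> = (\<Sum>(n, m)\<in>{- int N..int N} \<times> {- int N..int N}. f n * cnj (f m))"
    by (simp add: weyl_sum_def f_def sum_product sum.cartesian_product)
  also have "\<dots> = (\<Sum>(h, m)\<in>Sigma {- 2 * int N..2 * int N} (\<lambda>h. {l h..r h}). f (m + h) * cnj (f m))"
    by (rule sum.reindex_bij_witness[where i = "\<lambda>(h, m). (m + h, m)" and j = "\<lambda>(n, m). (n - m, m)"])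
       (auto simp: l_def r_def)
  also have "\<dots> = (\<Sum>h\<in>{- 2 * int N..2 * int N}. \<Sum>m\<in>{l h..r h}. f (m + h) * cnj (f m))"
    by (subst sum.Sigma) auto
  \<comment> \<open>The phase difference is \<open>x * h + t * h^2 + 2 * t * m * h\<close>: the part
    without m is the phase of \<open>f h\<close>, the rest is linear in m.\<close>
  also have "\<dots> = (\<Sum>h\<in>{- 2 * int N..2 * int N}. f h *
      (\<Sum>m\<in>{l h..r h}. cis (2 * pi * (of_int m * (of_int h * (2 * t))))))"
    unfolding sum_distrib_left f_def
    by (intro sum.cong refl)
       (simp add: cis_cnj cis_mult, simp add: algebra_simps power2_eq_square)
  finally have "(cmod (weyl_sum N x t))\<^sup>2 = cmod \<dots>"
    by (metis norm_of_real abs_of_nonneg zero_le_power2)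
  also have "\<dots> \<le> (\<Sum>h\<in>{- 2 * int N..2 * int N}. g h)"
    by (rule sum_norm_le) (simp add: norm_mult f_def g_def)
  finally have 1: "(cmod (weyl_sum N x t))\<^sup>2 \<le> (\<Sum>h\<in>{- 2 * int N..2 * int N}. g h)" .
  have 2: "g h \<le> 2 * real N + 1" for h
  proof -
    have "g h \<le> (\<Sum>m\<in>{l h..r h}. 1)" unfolding g_def by (rule sum_norm_le) simp
    also have "\<dots> \<le> (\<Sum>m\<in>{- int N..int N}. 1)"
      by (intro sum_mono2) (auto simp: l_def r_def)
    finally show ?thesis by simp
  qed
  show ?thesis
  proof (rule that[of g])
    show "g h * int_dist (of_int h * (2 * t)) \<le> 1/2" for h
      unfolding g_def by (rule geometric_cis_bound)
  qed (use 1 2 in \<open>simp_all add: g_def\<close>)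
qed

lemma harm_le: "n \<ge> 1 \<Longrightarrow> harm n \<le> 1 + ln (real n)"
proof (induction n rule: dec_induct)
  case base
  then show ?case by (simp add: harm_def)
next
  case (step n)
  have "ln (real n / real (Suc n)) \<le> real n / real (Suc n) - 1"
    using step by (intro ln_le_minus_one) auto
  then have "inverse (real (Suc n)) \<le> ln (real (Suc n)) - ln (real n)"
    using step by (simp add: ln_div field_simps)
  then show ?case using step by (simp add: harm_Suc)
qed

text \<open>With the circle cut into m cells of length 1/m, a point of cell j has j full cells below
  it and m - 1 - j above it, before an integer is reached.\<close>

lemma frac_cell_dist:
  assumes "m > 0" "j = nat \<lfloor>real m * frac y\<rfloor>"
  shows "j < m" "real (min j (m - 1 - j)) / real m \<le> int_dist y"
proof -
  have r: "0 \<le> frac y" "frac y < 1" by (auto simp: frac_lt_1)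
  have "0 \<le> real m * frac y" using r by simp
  then have a: "real j \<le> real m * frac y" "real m * frac y < real j + 1"
    unfolding assms(2) by linarith+
  have "real m * frac y < real m" using r assms by simp
  then have "real j < real m" using a by linarith
  then show j: "j < m" by simp
  have "real (min j (m - 1 - j)) \<le> real m * frac y" using a by linarith
  moreover have "real (min j (m - 1 - j)) \<le> real m * (1 - frac y)"
  proof -
    have "real (min j (m - 1 - j)) \<le> real (m - 1 - j)" by (simp only: of_nat_le_iff min.cobounded2)
    also have "\<dots> = real m - (real j + 1)" using j by linarith
    also have "\<dots> \<le> real m - real m * frac y" using a by linarith
    finally show ?thesis by (simp only: right_diff_distrib mult_1_right)
  qed
  ultimately show "real (min j (m - 1 - j)) / real m \<le> int_dist y"
    using assms(1) unfolding int_dist_def by (simp only: min_less_iff_conj min.bounded_iff pos_divide_le_eq of_nat_0_less_iff mult.commute[of _ "real m"] conj_absorb simp_thms)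
qed

text \<open>The multiples of \<open>y\<close> in the block are \<open>1/(2q)\<close>-separated modulo 1, so each of the
  \<open>2q\<close> cells of length \<open>1/(2q)\<close> contains at most one of them.\<close>

lemma block_sum_bound:
  fixes g :: "int \<Rightarrow> real" and L q :: nat
  assumes q: "q \<ge> 1" and cop: "coprime a (int q)" and ap: "\<bar>y - of_int a / real q\<bar> \<le> 1 / (real q)\<^sup>2"
    and L: "2 * L \<le> q + 1"
    and g: "\<And>h. 0 \<le> g h" "\<And>h. g h \<le> B" "\<And>h. g h * int_dist (of_int h * y) \<le> 1/2"
  shows "(\<Sum>h\<in>{c..<c + int L}. g h) \<le> 2 * (B + real q * (2 + ln (real q)))"
proof -
  define \<phi> where "\<phi> h = nat \<lfloor>real (2 * q) * frac (of_int h * y)\<rfloor>" for h :: int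
  \<comment> \<open>A bound for \<open>g\<close> on cell j. Only the trivial bound B holds in the
    two cells next to an integer; elsewhere the minimum of the two distances is replaced by the sum
    of both reciprocals. Division by zero gives 0, so the reciprocals contribute nothing at the
    ends.\<close>
  define w where "w j = (if j = 0 then B else 0) + (if j = 2 * q - 1 then B else 0)
    + real q / real j + real q / real (2 * q - 1 - j)" for j :: nat
  have B: "0 \<le> B" using g order_trans by blast
  have inj: "inj_on \<phi> {c..<c + int L}"
  proof (rule inj_onI, rule ccontr)
    fix h k assume hk: "h \<in> {c..<c + int L}" "k \<in> {c..<c + int L}" "\<phi> h = \<phi> k" "h \<noteq> k"
    have "\<lfloor>real (2 * q) * frac (of_int h * y)\<rfloor> = \<lfloor>real (2 * q) * frac (of_int k * y)\<rfloor>"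
      using hk(3) unfolding \<phi>_def by (simp add: eq_nat_nat_iff)
    then have "\<bar>real (2 * q) * frac (of_int h * y) - real (2 * q) * frac (of_int k * y)\<bar> < 1"
      by linarith
    then have "2 * real q * \<bar>frac (of_int h * y) - frac (of_int k * y)\<bar> < 1"
      by (simp add: abs_mult flip: right_diff_distrib)
    then have d: "\<bar>frac (of_int h * y) - frac (of_int k * y)\<bar> < 1 / (2 * real q)"
      using q by (simp add: field_simps)
    define r p where "r = h - k" and "p = \<lfloor>of_int h * y\<rfloor> - \<lfloor>of_int k * y\<rfloor>"
    have "of_int r * y - of_int p = frac (of_int h * y) - frac (of_int k * y)"
      by (simp add: r_def p_def frac_def algebra_simps)
    then have d: "\<bar>of_int r * y - of_int p\<bar> < 1 / (2 * real q)" using d by simp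
    have "\<bar>r\<bar> \<le> int L - 1" using hk by (auto simp: r_def)
    then have "2 * \<bar>r\<bar> \<le> int q" using L by linarith
    then have r: "\<bar>real_of_int r\<bar> \<le> real q / 2" by linarith
    \<comment> \<open>Sharing a cell costs less than 1/(2q), replacing y by a/q at most another
      1/(2q), since a block is short enough for |r| \<le> q/2. So the integer r * a - q * p has
      modulus below 1 and vanishes, and q divides the nonzero r, which is too small for
      that.\<close>
    have "\<bar>real_of_int r * of_int a / real q - of_int p\<bar>
      \<le> \<bar>of_int r * y - of_int p\<bar> + \<bar>of_int r\<bar> * \<bar>y - of_int a / real q\<bar>"
      by (simp flip: abs_mult add: algebra_simps)
    moreover have "\<bar>of_int r\<bar> * \<bar>y - of_int a / real q\<bar> \<le> (real q / 2) * (1 / (real q)\<^sup>2)"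
      by (intro mult_mono r ap) auto
    moreover have "(real q / 2) * (1 / (real q)\<^sup>2) = 1 / (2 * real q)"
      using q by (simp add: power2_eq_square)
    ultimately have "\<bar>real_of_int r * of_int a / real q - of_int p\<bar> < 1 / (2 * real q) + 1 / (2 * real q)"
      using d by linarith
    then have "real q * \<bar>real_of_int r * of_int a / real q - of_int p\<bar> < 1"
      using q by (simp add: field_simps)
    moreover have "real q * \<bar>real_of_int r * of_int a / real q - of_int p\<bar>
       = \<bar>real q * (real_of_int r * of_int a / real q - of_int p)\<bar>" by (simp add: abs_mult)
    moreover have "real q * (real_of_int r * of_int a / real q - of_int p) = of_int (r * a - int q * p)"
      using q by (simp add: field_simps)
    ultimately have "\<bar>real_of_int (r * a - int q * p)\<bar> < 1" by metis
    then have "r * a = int q * p" by linarith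
    then have "int q dvd r * a" by simp
    then have "int q dvd r" using cop by (simp add: coprime_commute coprime_dvd_mult_left_iff)
    moreover have "r \<noteq> 0" using hk by (simp add: r_def)
    ultimately have "int q \<le> \<bar>r\<bar>" using zdvd_imp_le by fastforce
    then show False using \<open>2 * \<bar>r\<bar> \<le> int q\<close> q by linarith
  qed
  have gw: "g h \<le> w (\<phi> h)" and \<phi>: "\<phi> h < 2 * q" for h
  proof -
    note c = frac_cell_dist[of "2 * q" "\<phi> h" "of_int h * y"]
    show lt: "\<phi> h < 2 * q" using c q unfolding \<phi>_def by auto
    define \<mu> where "\<mu> = min (\<phi> h) (2 * q - 1 - \<phi> h)"
    have "real \<mu> / real (2 * q) \<le> int_dist (of_int h * y)"
      using c(2) q unfolding \<phi>_def \<mu>_def by auto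
    then have "g h * (real \<mu> / real (2 * q)) \<le> 1/2"
      using g by (meson mult_left_mono order_trans)
    then have gm: "g h * real \<mu> \<le> real q" using q by (simp add: field_simps)
    show "g h \<le> w (\<phi> h)"
    proof (cases "\<mu> = 0")
      case True
      then have "\<phi> h = 0 \<or> \<phi> h = 2 * q - 1" using lt by (auto simp: \<mu>_def min_def split: if_splits)
      then have "B \<le> w (\<phi> h)" using B q unfolding w_def by auto
      then show ?thesis using g order_trans by blast
    next
      case False
      then have "g h \<le> real q / real \<mu>" using gm by (simp add: field_simps)
      also have "\<dots> \<le> real q / real (\<phi> h) + real q / real (2 * q - 1 - \<phi> h)"
        unfolding \<mu>_def min_def by auto
      also have "\<dots> \<le> w (\<phi> h)" using B unfolding w_def by auto
      finally show ?thesis .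
    qed
  qed
  have w0: "0 \<le> w j" for j using B by (simp add: w_def)
  have "(\<Sum>h\<in>{c..<c + int L}. g h) \<le> (\<Sum>h\<in>{c..<c + int L}. w (\<phi> h))"
    by (intro sum_mono gw)
  also have "\<dots> = (\<Sum>j\<in>\<phi> ` {c..<c + int L}. w j)" using inj by (simp add: sum.reindex)
  also have "\<dots> \<le> (\<Sum>j<2 * q. w j)" using \<phi> w0 by (intro sum_mono2) auto
  also have "\<dots> = 2 * B + (\<Sum>j<2*q. real q / real j) + (\<Sum>j<2*q. real q / real (2 * q - 1 - j))"
    unfolding w_def sum.distrib using q by simp
  also have "(\<Sum>j<2*q. real q / real (2 * q - 1 - j)) = (\<Sum>j<2*q. real q / real j)"
    by (rule sum.reindex_bij_witness[where i = "\<lambda>j. 2*q - 1 - j" and j = "\<lambda>j. 2*q - 1 - j"]) auto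
  also have "(\<Sum>j<2*q. real q / real j) = (\<Sum>j\<in>{1..2*q-1}. real q / real j)"
    by (rule sum.mono_neutral_cong_right) auto
  also have "\<dots> = real q * harm (2*q-1)" by (simp add: harm_def sum_distrib_left divide_inverse)
  also have "harm (2*q-1) \<le> 1 + ln (real (2 * q - 1))" using q by (intro harm_le) auto
  also have "ln (real (2 * q - 1)) \<le> ln (2 * real q)" using q by (intro ln_mono) auto
  also have "\<dots> \<le> 1 + ln (real q)" using q ln_2_less_1 by (simp add: ln_mult)
  finally show ?thesis using q by (simp add: algebra_simps)
qed

text \<open>The differencing shifts h fill an interval of length about 4N, which is cut into blocks
  of about q/2 consecutive shifts. There are at most 8N/q + 1 blocks, and each is controlled by
  \<open>block_sum_bound\<close>. The sum may be shorter than N so that N can be taken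
  dyadic.\<close>

lemma weyl_bound:
  assumes q: "q \<ge> 1" and cop: "coprime a (int q)" and ap: "\<bar>2 * t - of_int a / real q\<bar> \<le> 1 / (real q)\<^sup>2"
    and N: "N' \<le> N"
  shows "(cmod (weyl_sum N' x t))\<^sup>2 \<le> (8 * real N / real q + 1) * (2 * (2 * real N + 1 + real q * (2 + ln (real q))))"
proof -
  obtain g :: "int \<Rightarrow> real" where g: "\<And>h. 0 \<le> g h" "\<And>h. g h \<le> 2 * real N' + 1"
     "\<And>h. g h * int_dist (of_int h * (2 * t)) \<le> 1/2"
     "(cmod (weyl_sum N' x t))\<^sup>2 \<le> (\<Sum>h\<in>{- 2 * int N'..2 * int N'}. g h)"
    using weyl_differencing by blast
  define L where "L = (q + 1) div 2"
  have L: "2 * L \<le> q + 1" "q \<le> 2 * L" "L \<ge> 1" using q by (auto simp: L_def)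
  define R where "R = 2 * (2 * real N + 1 + real q * (2 + ln (real q)))"
  have blk: "(\<Sum>h\<in>{c..<c + int L}. g h) \<le> R" for c
  proof -
    have "g h \<le> 2 * real N + 1" for h using g(2)[of h] N by (simp add: order_trans)
    then show ?thesis unfolding R_def using block_sum_bound[OF q cop ap L(1) g(1) _ g(3)] by blast
  qed
  \<comment> \<open>Since \<open>K * L\<close> exceeds 4N, K blocks starting at -2N cover all
    shifts; the surplus shifts do no harm because g is nonnegative.\<close>
  define K where "K = 4 * N div L + 1"
  have "(\<Sum>h\<in>{- 2 * int N'..2 * int N'}. g h) \<le> (\<Sum>h\<in>{- 2 * int N..<- 2 * int N + int (K * L)}. g h)"
  proof (intro sum_mono2)
    have "4 * N < K * L"
      unfolding K_def using L(3) dividend_less_div_times[of L "4 * N"] by (simp add: add.commute)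
    then have "4 * int N < int (K * L)" by (metis of_nat_less_iff of_nat_mult of_nat_numeral)
    then show "{- 2 * int N'..2 * int N'} \<subseteq> {- 2 * int N..<- 2 * int N + int (K * L)}"
      using N by auto
  qed (use g in auto)
  also have "\<dots> = (\<Sum>j<K * L. g (- 2 * int N + int j))"
    by (rule sum.reindex_bij_witness[where i = "\<lambda>j. - 2 * int N + int j" and j = "\<lambda>h. nat (h + 2 * int N)"])
       (auto simp: nat_less_iff simp flip: of_nat_mult)
  also have "\<dots> = (\<Sum>b<K. \<Sum>j\<in>{b * L..<b * L + L}. g (- 2 * int N + int j))"
    by (rule sum.nat_group[symmetric])
  also have "\<dots> \<le> (\<Sum>b<K. R)"
  proof (rule sum_mono)
    fix b
    define u where "u = b * L"
    have "(\<Sum>j\<in>{u..<u + L}. g (- 2 * int N + int j))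
       = (\<Sum>h\<in>{(- 2 * int N + int u)..<(- 2 * int N + int u) + int L}. g h)"
      by (rule sum.reindex_bij_witness[where j = "\<lambda>j. - 2 * int N + int j" and i = "\<lambda>h. nat (h + 2 * int N)"])
         auto
    then show "(\<Sum>j\<in>{b * L..<b * L + L}. g (- 2 * int N + int j)) \<le> R" using blk unfolding u_def by simp
  qed
  also have "\<dots> = real K * R" by simp
  also have "\<dots> \<le> (8 * real N / real q + 1) * R"
  proof (intro mult_right_mono)
    have "real K \<le> real (4 * N) / real L + 1" unfolding K_def using of_nat_div_le_of_nat[of "4 * N" L, where ?'a = real] by simp
    also have "real (4 * N) / real L \<le> real (4 * N) / (real q / 2)"
      using L q by (intro divide_left_mono) (auto simp: field_simps)
    finally show "real K \<le> 8 * real N / real q + 1" by simp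
    show "0 \<le> R" using g order_trans[OF _ blk] sum_nonneg by (metis g(1))
  qed
  finally show ?thesis using g(4) unfolding R_def by (rule order_trans[rotated])
qed

section \<open>Major arcs\<close>

text \<open>The tolerance is the reciprocal of the cutoff \<open>4^k / 2^i\<close> in Dirichlet's
  theorem, so that a point outside has a Dirichlet denominator between \<open>2^i\<close> and this
  cutoff. At i = 0 no denominator is admissible and the set is empty.\<close>

definition major_arcs :: "nat \<Rightarrow> nat \<Rightarrow> real set" where
  "major_arcs k i = {y. \<exists>(q::nat) (a::int). 1 \<le> q \<and> q < 2^i \<and> \<bar>real q * y - of_int a\<bar> < 2^i / 4^k}"

text \<open>Dirichlet's theorem with cutoff \<open>P = 4^k / 2^i\<close> gives a denominator q \<le>
  P, and lying off the major arcs forces q \<ge> \<open>2^i\<close>. Then the three quantities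
  \<open>4^k / q\<close>, \<open>2^k\<close> and q in the Weyl bound are all at most P; the
  logarithm of q costs the factor \<open>1 + k\<close>.\<close>

lemma weyl_sum_minor_arcs:
  assumes i: "i \<le> k" and N: "N \<le> 2^k" and minor: "2 * t \<notin> major_arcs k i"
  shows "(cmod (weyl_sum N x t))\<^sup>2 \<le> 90 * (1 + real k) * (4^k / 2^i)"
proof -
  define P :: real where "P = 4^k / 2^i"
  define R :: nat where "R = 2^(2*k-i)"
  have RP: "real R = P"
  proof -
    have "real R = 2^(2*k-i)" by (simp add: R_def)
    also have "\<dots> = 2^(2*k) / 2^i" using i by (intro power_diff) auto
    finally show ?thesis by (simp add: P_def power_mult)
  qed
  obtain a q' where aq: "coprime a q'" "0 < q'" "q' \<le> int R" "\<bar>of_int q' * (2 * t) - of_int a\<bar> < 1 / real R"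
    using Dirichlet_approx_coprime[of R "2 * t"] unfolding R_def by auto
  define q where "q = nat q'"
  have q: "q' = int q" "q \<ge> 1" using aq by (auto simp: q_def)
  have qP: "real q \<le> P" using aq(3) q RP by linarith
  have "1 / real R = 2^i / 4^k" by (simp add: RP P_def)
  then have "2^i \<le> q" using minor aq q unfolding major_arcs_def by force
  then have q2: "2^i \<le> real q" by (metis of_nat_le_iff of_nat_numeral of_nat_power)
  have "\<bar>2 * t - of_int a / real q\<bar> = \<bar>real q * (2 * t) - of_int a\<bar> / real q"
  proof -
    have "2 * t - of_int a / real q = (real q * (2 * t) - of_int a) / real q"
      using q by (simp add: field_simps)
    then show ?thesis by (simp add: abs_divide)
  qed
  also have "\<dots> \<le> (1 / real R) / real q"
    using aq q by (intro divide_right_mono) auto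
  also have "\<dots> \<le> (1 / real q) / real q"
    using qP RP q by (intro divide_right_mono divide_left_mono) auto
  finally have ap: "\<bar>2 * t - of_int a / real q\<bar> \<le> 1 / (real q)\<^sup>2" by (simp add: power2_eq_square)
  define M :: real where "M = 2^k"
  define l where "l = 2 + ln (real q)"
  have "(cmod (weyl_sum N x t))\<^sup>2
      \<le> (8 * real (2^k) / real q + 1) * (2 * (2 * real (2^k) + 1 + real q * (2 + ln (real q))))"
    by (rule weyl_bound[of q a]) (use aq q ap N in auto)
  then have "(cmod (weyl_sum N x t))\<^sup>2 \<le> (8 * M / real q + 1) * (2 * (2 * M + 1 + real q * l))"
    by (simp add: M_def l_def)
  also have "\<dots> \<le> (8 * M / real q + 1) * (2 * (3 * M + real q * l))"
    by (intro mult_left_mono) (auto simp: M_def)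
  also have "\<dots> = 2 * (24 * (M * M / real q) + 8 * (M * l) + 3 * M + real q * l)"
    using q by (simp add: field_simps)
  also have "\<dots> \<le> 2 * (24 * P + 8 * (P * l) + 3 * P + P * l)"
  proof -
    have "M * M / real q \<le> M * M / 2^i" using q2 q(2) by (intro divide_left_mono mult_pos_pos) (auto simp: M_def)
    also have "\<dots> = P" by (simp add: M_def P_def flip: power_mult_distrib)
    finally have 1: "M * M / real q \<le> P" .
    have "M = M * M / 2^k" by (simp add: M_def)
    also have "\<dots> \<le> M * M / 2^i" using i by (intro divide_left_mono) (auto simp: M_def power_increasing)
    also have "\<dots> = P" by (simp add: M_def P_def flip: power_mult_distrib)
    finally have 2: "M \<le> P" .
    have l: "0 \<le> l" using q by (simp add: l_def)
    show ?thesis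
      using 1 2 mult_right_mono[OF 2 l] mult_right_mono[OF qP l] by (intro mult_left_mono add_mono) simp_all
  qed
  also have "\<dots> = P * (54 + 18 * l)" by (simp add: algebra_simps)
  also have "\<dots> \<le> P * (90 + 36 * real k)"
  proof -
    have "ln (real q) \<le> ln (4^k)"
    proof -
      have "P \<le> 4^k" by (simp add: P_def divide_le_eq)
      then have "real q \<le> 4^k" using qP by (rule order_trans[rotated])
      then show ?thesis using q by (intro ln_mono) simp_all
    qed
    also have "\<dots> = real k * ln 4" by (simp add: ln_realpow)
    also have "ln (4::real) = 2 * ln 2" using ln_realpow[of "2::real" 2] by simp
    also have "real k * (2 * ln 2) \<le> real k * 2" using ln_2_less_1 by (intro mult_left_mono) auto
    finally show ?thesis unfolding l_def by (intro mult_left_mono) (auto simp: P_def)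
  qed
  also have "\<dots> \<le> P * (90 * (1 + real k))" by (intro mult_left_mono) (auto simp: P_def)
  finally show ?thesis by (simp add: P_def mult_ac)
qed

text \<open>An enlargement of \<open>major_arcs k (i + 1)\<close> that absorbs rounding the time to a multiple of
  \<open>4^(-k)\<close>. At the top level \<open>i = k\<close> nothing is required.\<close>

definition wide_arcs :: "nat \<Rightarrow> nat \<Rightarrow> real set" where
  "wide_arcs k i = (if i < k then
     {y. \<exists>(q::nat) (a::int). 1 \<le> q \<and> q < 2^(i+1) \<and> \<bar>real q * y - of_int a\<bar> \<le> 10 * 2^i / 4^k} else UNIV)"

text \<open>The constant 10 in \<open>wide_arcs\<close> is 2 + 8: the tolerance of level i + 1 is
  \<open>2 * 2^i / 4^k\<close>, and moving y by \<open>4 / 4^k\<close> changes q * y by at most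
  \<open>8 * 2^i / 4^k\<close>.\<close>

lemma wide_arcs_near_major_arcs:
  assumes "y \<in> major_arcs k (Suc i)" "\<bar>y - y'\<bar> \<le> 4 / 4^k"
  shows "y' \<in> wide_arcs k i"
proof (cases "i < k")
  case True
  obtain q :: nat and a :: int where qa: "1 \<le> q" "q < 2^(i+1)" "\<bar>real q * y - of_int a\<bar> < 2^(i+1) / 4^k"
    using assms(1) unfolding major_arcs_def by auto
  have "real q \<le> 2^(i+1)" using qa(2) by (metis less_imp_le of_nat_le_iff of_nat_numeral of_nat_power)
  then have "real q * \<bar>y - y'\<bar> \<le> 2^(i+1) * (4 / 4^k)"
    using assms(2) by (intro mult_mono) auto
  then have "\<bar>real q * y - real q * y'\<bar> \<le> 8 * 2^i / 4^k"
    by (simp flip: right_diff_distrib add: abs_mult)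
  moreover have "(2::real)^(i+1) / 4^k = 2 * 2^i / 4^k" "10 * (2::real)^i / 4^k = 2 * 2^i/4^k + 8 * 2^i / 4^k"
    by (simp_all add: field_simps)
  ultimately have "\<bar>real q * y' - of_int a\<bar> \<le> 10 * 2^i / 4^k" using qa(3) by linarith
  then show ?thesis using True qa unfolding wide_arcs_def by auto
qed (simp add: wide_arcs_def)

text \<open>For s \<ge> \<open>3 / 2^k\<close> the tolerance is below 2s, which rules out numerators
  a \<le> 0. Only about q * s numerators then remain for each denominator q, and this
  proportionality to s is what makes the measure bound uniform in time.\<close>

lemma wide_arcs_cover:
  assumes i: "i < k" and s: "3 / 2^k \<le> s" and b: "1 \<le> b" "b \<le> 2" and y: "2 * b * s \<in> wide_arcs k i"
  obtains q a :: nat where "q \<in> {1..<2^(i+1)}" "a \<in> {1..nat \<lfloor>6 * real q * s\<rfloor>}"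
    "\<bar>2 * real q * b * s - real a\<bar> \<le> 10 * 2^i / 4^k"
proof -
  define \<rho> :: real where "\<rho> = 10 * 2^i / 4^k"
  obtain q :: nat and a :: int where qa: "1 \<le> q" "q < 2^(i+1)" "\<bar>real q * (2 * b * s) - of_int a\<bar> \<le> \<rho>"
    using i y unfolding wide_arcs_def \<rho>_def by auto
  have s0: "s > 0" using s by (rule less_le_trans[rotated]) simp
  have "(2::real) * 2^i \<le> 2^k" using i power_increasing[of "Suc i" k "2::real"] by simp
  then have "\<rho> \<le> 5 * 2^k / 4^k" unfolding \<rho>_def by (intro divide_right_mono) auto
  also have "\<dots> = 5 / 2^k" by (simp add: field_simps flip: power_mult_distrib)
  also have "\<dots> < 2 * s"
  proof -
    have "(5::real) / 2^k < 2 * (3 / 2^k)" by (simp add: field_simps)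
    then show ?thesis using s by linarith
  qed
  finally have \<rho>: "\<rho> < 2 * s" .
  have "1 * (2 * 1 * s) \<le> real q * (2 * b * s)" using qa b s0 by (intro mult_mono) auto
  then have "real_of_int a > 0" using qa(3) \<rho> by linarith
  then have a0: "a \<ge> 1" by simp
  have "real q * (2 * b * s) \<le> real q * (2 * 2 * s)" using b s0 by (intro mult_left_mono mult_right_mono) auto
  moreover have "2 * s \<le> 2 * (real q * s)" using qa s0 by simp
  ultimately have "of_int a \<le> 6 * real q * s" using qa(3) \<rho> by linarith
  then have "a \<le> \<lfloor>6 * real q * s\<rfloor>" by (simp add: le_floor_iff)
  then have "nat a \<in> {1..nat \<lfloor>6 * real q * s\<rfloor>}" using a0 by auto
  moreover have "\<bar>2 * real q * b * s - real (nat a)\<bar> \<le> 10 * 2^i / 4^k"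
    using qa(3) a0 unfolding \<rho>_def by (simp add: mult_ac)
  ultimately show ?thesis using that[of q "nat a"] qa by auto
qed

section \<open>Measure of the wide arcs in the parameter, and their count among the discrete
  times\<close>

lemma wide_arcs_borel [measurable]: "wide_arcs k i \<in> sets borel"
proof -
  have "{y \<in> space borel. \<exists>(q::nat) (a::int). 1 \<le> q \<and> q < 2^(i+1) \<and> \<bar>real q * y - of_int a\<bar> \<le> 10 * 2^i / 4^k}
    \<in> sets borel"
    by measurable
  then show ?thesis by (simp add: wide_arcs_def)
qed

text \<open>With \<rho> the tolerance, each pair (q, a) confines b to an interval of length
  \<rho>/(q s). At most 6 q s numerators give 6 \<rho> for each q, independently of s, and there are
  fewer than \<open>2^(i+1)\<close> denominators. At i = k the trivial bound 1 is enough.\<close>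

lemma emeasure_wide_arcs:
  assumes i: "i \<le> k" and s: "3 / 2^k \<le> s"
  shows "emeasure lborel {b\<in>{1..2}. 2 * b * s \<in> wide_arcs k i} \<le> ennreal (120 * 4^i / 4^k)"
proof (cases "i < k")
  case False
  then have [simp]: "i = k" using i by simp
  have "emeasure lborel {b\<in>{1..2}. 2 * b * s \<in> wide_arcs k i} \<le> emeasure lborel {1..2::real}"
    by (intro emeasure_mono) auto
  also have "\<dots> \<le> ennreal (120 * 4^i / 4^k)" by simp
  finally show ?thesis .
next
  case True
  define \<rho> :: real where "\<rho> = 10 * 2^i / 4^k"
  have \<rho>: "\<rho> \<ge> 0" by (simp add: \<rho>_def)
  have s0: "s > 0" using s by (rule less_le_trans[rotated]) simp
  define J :: "nat \<Rightarrow> nat \<Rightarrow> real set"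
    where "J q a = {(real a - \<rho>) / (2 * real q * s)..(real a + \<rho>) / (2 * real q * s)}" for q a
  have J: "emeasure lborel (J q a) = ennreal (\<rho> / (real q * s))" if "q \<ge> 1" for q a
  proof -
    have "(real a - \<rho>) / (2 * real q * s) \<le> (real a + \<rho>) / (2 * real q * s)"
      using \<rho> s0 by (intro divide_right_mono) auto
    moreover have "(real a + \<rho>) / (2 * real q * s) - (real a - \<rho>) / (2 * real q * s) = \<rho> / (real q * s)"
      using s0 that by (simp add: field_simps)
    ultimately show ?thesis unfolding J_def by simp
  qed
  have "{b\<in>{1..2}. 2 * b * s \<in> wide_arcs k i} \<subseteq> (\<Union>q\<in>{1..<2^(i+1)}. \<Union>a\<in>{1..nat \<lfloor>6 * real q * s\<rfloor>}. J q a)"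
  proof
    fix b assume "b \<in> {b\<in>{1..2}. 2 * b * s \<in> wide_arcs k i}"
    then have b: "1 \<le> b" "b \<le> 2" "2 * b * s \<in> wide_arcs k i" by auto
    obtain q a :: nat where qa: "q \<in> {1..<2^(i+1)}" "a \<in> {1..nat \<lfloor>6 * real q * s\<rfloor>}"
      "\<bar>2 * real q * b * s - real a\<bar> \<le> 10 * 2^i / 4^k"
      using wide_arcs_cover[OF True s b] .
    have "real a - \<rho> \<le> b * (2 * real q * s)" "b * (2 * real q * s) \<le> real a + \<rho>"
      using qa(3) unfolding \<rho>_def abs_le_iff by (simp_all add: mult_ac)
    moreover have "2 * real q * s > 0" using qa s0 by simp
    ultimately have "b \<in> J q a" unfolding J_def by (simp add: pos_divide_le_eq pos_le_divide_eq)
    then show "b \<in> (\<Union>q\<in>{1..<2^(i+1)}. \<Union>a\<in>{1..nat \<lfloor>6 * real q * s\<rfloor>}. J q a)" using qa by blast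
  qed
  then have "emeasure lborel {b\<in>{1..2}. 2 * b * s \<in> wide_arcs k i}
     \<le> emeasure lborel (\<Union>q\<in>{1..<2^(i+1)}. \<Union>a\<in>{1..nat \<lfloor>6 * real q * s\<rfloor>}. J q a)"
    by (intro emeasure_mono) (auto simp: J_def)
  also have "\<dots> \<le> (\<Sum>q\<in>{1..<2^(i+1)}. emeasure lborel (\<Union>a\<in>{1..nat \<lfloor>6 * real q * s\<rfloor>}. J q a))"
    by (intro emeasure_subadditive_finite) (auto simp: J_def)
  also have "\<dots> \<le> (\<Sum>q\<in>{1..<2^(i+1)::nat}. ennreal (6 * \<rho>))"
  proof (rule sum_mono)
    fix q :: nat assume q: "q \<in> {1..<2^(i+1)}"
    have "emeasure lborel (\<Union>a\<in>{1..nat \<lfloor>6 * real q * s\<rfloor>}. J q a)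
       \<le> (\<Sum>a\<in>{1..nat \<lfloor>6 * real q * s\<rfloor>}. emeasure lborel (J q a))"
      by (intro emeasure_subadditive_finite) (auto simp: J_def)
    also have "\<dots> = ennreal (real (nat \<lfloor>6 * real q * s\<rfloor>) * (\<rho> / (real q * s)))"
    proof -
      have "(\<Sum>a\<in>{1..nat \<lfloor>6 * real q * s\<rfloor>}. emeasure lborel (J q a))
        = of_nat (nat \<lfloor>6 * real q * s\<rfloor>) * ennreal (\<rho> / (real q * s))"
        using q J by simp
      then show ?thesis using \<rho> s0 by (subst ennreal_mult) (auto simp: ennreal_of_nat_eq_real_of_nat)
    qed
    also have "\<dots> \<le> ennreal ((6 * real q * s) * (\<rho> / (real q * s)))"
      using s0 \<rho> by (intro ennreal_leI mult_right_mono) auto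
    also have "(6 * real q * s) * (\<rho> / (real q * s)) = 6 * \<rho>" using q s0 by simp
    finally show "emeasure lborel (\<Union>a\<in>{1..nat \<lfloor>6 * real q * s\<rfloor>}. J q a) \<le> ennreal (6 * \<rho>)" .
  qed
  also have "\<dots> = ennreal (real (2^(i+1) - 1) * (6 * \<rho>))"
  proof -
    have "(\<Sum>q\<in>{1..<2^(i+1)::nat}. ennreal (6 * \<rho>)) = of_nat (2^(i+1) - 1) * ennreal (6 * \<rho>)"
      by (simp only: sum_constant card_atLeastLessThan)
    then show ?thesis using \<rho> by (simp only: ennreal_of_nat_eq_real_of_nat ennreal_mult' of_nat_0_le_iff)
  qed
  also have "\<dots> \<le> ennreal (2^(i+1) * (6 * \<rho>))"
    using \<rho> by (intro ennreal_leI mult_right_mono) auto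
  also have "(2^(i+1) * (6 * \<rho>)) = 120 * 4^i / 4^k"
    unfolding \<rho>_def by (simp add: field_simps flip: power_mult_distrib)
  finally show ?thesis .
qed

lemma card_nat_interval_le:
  assumes "r \<ge> 0"
  shows "finite {m::nat. \<bar>real m - c\<bar> \<le> r}" "real (card {m::nat. \<bar>real m - c\<bar> \<le> r}) \<le> 2 * r + 1"
proof -
  have sub: "{m::nat. \<bar>real m - c\<bar> \<le> r} \<subseteq> nat ` {\<lceil>c - r\<rceil>..\<lfloor>c + r\<rfloor>}"
  proof
    fix m :: nat assume "m \<in> {m. \<bar>real m - c\<bar> \<le> r}"
    then have "c - r \<le> real m" "real m \<le> c + r" by auto
    then have "int m \<in> {\<lceil>c - r\<rceil>..\<lfloor>c + r\<rfloor>}" by (auto simp: ceiling_le_iff le_floor_iff)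
    then show "m \<in> nat ` {\<lceil>c - r\<rceil>..\<lfloor>c + r\<rfloor>}" by (metis image_eqI nat_int)
  qed
  then show "finite {m::nat. \<bar>real m - c\<bar> \<le> r}" by (rule finite_subset) auto
  have "card {m::nat. \<bar>real m - c\<bar> \<le> r} \<le> card (nat ` {\<lceil>c - r\<rceil>..\<lfloor>c + r\<rfloor>})"
    using sub by (intro card_mono) auto
  also have "\<dots> \<le> card {\<lceil>c - r\<rceil>..\<lfloor>c + r\<rfloor>}" by (rule card_image_le) simp
  also have "\<dots> = nat (\<lfloor>c + r\<rfloor> - \<lceil>c - r\<rceil> + 1)" by simp
  finally have "real (card {m::nat. \<bar>real m - c\<bar> \<le> r}) \<le> real (nat (\<lfloor>c + r\<rfloor> - \<lceil>c - r\<rceil> + 1))"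
    by simp
  also have "\<dots> \<le> 2 * r + 1" using assms by linarith
  finally show "real (card {m::nat. \<bar>real m - c\<bar> \<le> r}) \<le> 2 * r + 1" .
qed

text \<open>Here m encodes the time \<open>m / 4^k\<close>. The first coefficient of the quadratic
  form is fixed to 1, so the level of the first factor restricts the time and not a
  parameter.\<close>

definition grid :: "nat \<Rightarrow> nat \<Rightarrow> nat set" where
  "grid k i = {m\<in>{3 * 2^k..4^k}. 2 * (real m / 4^k) \<in> wide_arcs k i}"

lemma grid_ge:
  assumes "m \<in> grid k i"
  shows "3 / 2^k \<le> real m / 4^k"
proof -
  have "3 * 2^k \<le> m" using assms by (auto simp: grid_def)
  then have "real (3 * 2^k) \<le> real m" by (simp only: of_nat_le_iff)
  then have "3 * 2^k \<le> real m" by simp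
  then have "(3 * 2^k) / 4^k \<le> real m / 4^k" by (intro divide_right_mono) auto
  moreover have "(3 * 2^k) / 4^k = (3::real) / 2^k" by (simp add: field_simps flip: power_mult_distrib)
  ultimately show ?thesis by simp
qed

text \<open>Each pair (q, a) with a \<le> 6q admits the m within \<open>5 * 2^i / q\<close> of one
  centre, hence at most \<open>10 * 2^i / q + 1\<close> of them. As q \<le> \<open>2^(i+1)\<close>,
  the extra 1 is harmless: each q contributes at most \<open>72 * 2^i\<close>.\<close>

lemma card_grid_le:
  assumes i: "i \<le> k"
  shows "real (card (grid k i)) \<le> 144 * 4^i"
proof (cases "i < k")
  case False
  then have [simp]: "i = k" using i by simp
  have "card (grid k i) \<le> card {1..4^k::nat}"
  proof (intro card_mono subsetI)
    fix m assume "m \<in> grid k i"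
    then have "3 * 2^k \<le> m" "m \<le> 4^k" by (auto simp: grid_def)
    moreover have "(1::nat) \<le> 3 * 2^k" by simp
    ultimately show "m \<in> {1..4^k}" unfolding atLeastAtMost_iff by linarith
  qed simp
  then have "card (grid k i) \<le> 4^k" by simp
  then have "real (card (grid k i)) \<le> 4^k" by (metis of_nat_le_iff of_nat_numeral of_nat_power)
  also have "\<dots> \<le> 144 * 4^k" by simp
  finally show ?thesis by simp
next
  case True
  define \<rho> :: real where "\<rho> = 10 * 2^i / 4^k"
  define J :: "nat \<Rightarrow> nat \<Rightarrow> nat set"
    where "J q a = {m. \<bar>real m - real a * 4^k / (2 * real q)\<bar> \<le> 5 * 2^i / real q}" for q a
  have J: "finite (J q a)" "real (card (J q a)) \<le> 10 * 2^i / real q + 1" for q a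
    unfolding J_def using card_nat_interval_le[of "5 * 2^i / real q" "real a * 4^k / (2 * real q)"] by auto
  have "grid k i \<subseteq> (\<Union>q\<in>{1..<2^(i+1)}. \<Union>a\<in>{1..6*q}. J q a)"
  proof
    fix m assume "m \<in> grid k i"
    then have m: "3 * 2^k \<le> m" "m \<le> 4^k" "2 * 1 * (real m / 4^k) \<in> wide_arcs k i" by (auto simp: grid_def)
    have s: "3 / 2^k \<le> real m / 4^k" using \<open>m \<in> grid k i\<close> by (rule grid_ge)
    obtain q a :: nat where qa: "q \<in> {1..<2^(i+1)}" "a \<in> {1..nat \<lfloor>6 * real q * (real m / 4^k)\<rfloor>}"
      "\<bar>2 * real q * 1 * (real m / 4^k) - real a\<bar> \<le> 10 * 2^i / 4^k"
      using wide_arcs_cover[OF True s _ _ m(3)] by auto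
    have "real m \<le> 4^k" using m(2) by (metis of_nat_le_iff of_nat_numeral of_nat_power)
    then have "6 * real q * (real m / 4^k) \<le> 6 * real q * 1" by (intro mult_left_mono) auto
    then have "nat \<lfloor>6 * real q * (real m / 4^k)\<rfloor> \<le> 6 * q" by linarith
    then have "a \<in> {1..6*q}" using qa by auto
    moreover have "m \<in> J q a"
    proof -
      have q0: "real q > 0" using qa by simp
      have "real m - real a * 4^k / (2 * real q)
          = (2 * real q * 1 * (real m / 4^k) - real a) * (4^k / (2 * real q))"
        using q0 by (simp add: field_simps)
      then have "\<bar>real m - real a * 4^k / (2 * real q)\<bar>
          = \<bar>2 * real q * 1 * (real m / 4^k) - real a\<bar> * (4^k / (2 * real q))"
        using q0 by (simp add: abs_mult)
      also have "\<dots> \<le> 10 * 2^i / 4^k * (4^k / (2 * real q))"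
        using qa(3) q0 by (intro mult_right_mono) auto
      also have "\<dots> = 5 * 2^i / real q" using q0 by simp
      finally show ?thesis by (simp add: J_def)
    qed
    ultimately show "m \<in> (\<Union>q\<in>{1..<2^(i+1)}. \<Union>a\<in>{1..6*q}. J q a)" using qa by blast
  qed
  then have "card (grid k i) \<le> card (\<Union>q\<in>{1..<2^(i+1)}. \<Union>a\<in>{1..6*q}. J q a)"
    using J by (intro card_mono) auto
  also have "\<dots> \<le> (\<Sum>q\<in>{1..<2^(i+1)}. card (\<Union>a\<in>{1..6*q}. J q a))" by (rule card_UN_le) simp
  also have "\<dots> \<le> (\<Sum>q\<in>{1..<2^(i+1)}. \<Sum>a\<in>{1..6*q}. card (J q a))"
    by (intro sum_mono card_UN_le) simp
  finally have "real (card (grid k i)) \<le> real (\<Sum>q\<in>{1..<2^(i+1)}. \<Sum>a\<in>{1..6*q}. card (J q a))"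
    by (simp only: of_nat_le_iff)
  also have "\<dots> = (\<Sum>q\<in>{1..<2^(i+1)}. \<Sum>a\<in>{1..6*q}. real (card (J q a)))"
    by (simp only: of_nat_sum)
  also have "\<dots> \<le> (\<Sum>q\<in>{1..<2^(i+1)}. \<Sum>a\<in>{1..6*q}. 10 * 2^i / real q + 1)"
    by (intro sum_mono J)
  also have "\<dots> = (\<Sum>q\<in>{1..<2^(i+1)::nat}. 60 * 2^i + 6 * real q)"
    by (intro sum.cong refl) (auto simp: field_simps)
  also have "\<dots> \<le> (\<Sum>q\<in>{1..<2^(i+1)::nat}. 72 * 2^i)"
  proof (rule sum_mono)
    fix q :: nat assume "q \<in> {1..<2^(i+1)}"
    then have "real q \<le> 2^(i+1)" by (metis atLeastLessThan_iff less_imp_le of_nat_le_iff of_nat_numeral of_nat_power)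
    then show "60 * 2^i + 6 * real q \<le> 72 * 2^i" by simp
  qed
  also have "\<dots> = real (2^(i+1) - 1) * (72 * 2^i)" by simp
  also have "\<dots> \<le> 2^(i+1) * (72 * 2^i)" by (intro mult_right_mono) auto
  also have "\<dots> = 144 * 4^i" by (simp flip: power_mult_distrib)
  finally show ?thesis .
qed

section \<open>Exceptional parameters\<close>

definition exceptional_box :: "nat \<Rightarrow> nat \<Rightarrow> nat \<Rightarrow> (nat \<Rightarrow> nat) \<Rightarrow> (nat \<Rightarrow> real) set" where
  "exceptional_box d k m \<iota> = (\<Pi>\<^sub>E j\<in>{2..d}. {b\<in>{1..2}. 2 * b * (real m / 4^k) \<in> wide_arcs k (\<iota> j)})"

text \<open>The threshold separates two regimes: level tuples below it make the exceptional measure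
  summable in k, while above it the product of the Weyl bounds is already small enough.\<close>

definition level_tuples :: "nat \<Rightarrow> nat \<Rightarrow> real \<Rightarrow> (nat \<Rightarrow> nat) set" where
  "level_tuples d k \<eta> = {\<iota> \<in> (\<Pi>\<^sub>E j\<in>{1..d}. {..k}). real (\<Sum>j=1..d. \<iota> j) \<le> real k * (real d - 1 - \<eta>)}"

definition exceptional_set :: "nat \<Rightarrow> real \<Rightarrow> nat \<Rightarrow> (nat \<Rightarrow> real) set" where
  "exceptional_set d \<eta> k = (\<Union>\<iota>\<in>level_tuples d k \<eta>. \<Union>m\<in>grid k (\<iota> 1). exceptional_box d k m \<iota>)"

lemma finite_level_tuples [simp]: "finite (level_tuples d k \<eta>)"
proof (rule finite_subset)
  show "level_tuples d k \<eta> \<subseteq> (\<Pi>\<^sub>E j\<in>{1..d}. {..k})" by (auto simp: level_tuples_def)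
qed (auto intro: finite_PiE)

lemma card_level_tuples_le: "card (level_tuples d k \<eta>) \<le> (k + 1) ^ d"
proof -
  have "card (level_tuples d k \<eta>) \<le> card (\<Pi>\<^sub>E j\<in>{1..d}. {..k})"
    by (intro card_mono finite_PiE) (auto simp: level_tuples_def)
  then show ?thesis by (simp add: card_PiE)
qed

lemma finite_grid [simp]: "finite (grid k i)"
  by (rule finite_subset[of _ "{3 * 2^k..4^k}"]) (auto simp: grid_def)

lemma wide_arcs_section_measurable: "{b\<in>{1..2}. 2 * b * s \<in> wide_arcs k i} \<in> sets lborel"
proof -
  have "{b \<in> space borel. b \<in> {1..2} \<and> 2 * b * s \<in> wide_arcs k i} \<in> sets borel" by measurable
  then show ?thesis by simp
qed

lemma sets_exceptional_box: "exceptional_box d k m \<iota> \<in> sets (\<Pi>\<^sub>M j\<in>{2..d}. lborel)"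
  unfolding exceptional_box_def by (intro sets_PiM_I_finite wide_arcs_section_measurable) auto

lemma sets_exceptional_set: "exceptional_set d \<eta> k \<in> sets (\<Pi>\<^sub>M j\<in>{2..d}. lborel)"
  unfolding exceptional_set_def by (intro sets.finite_UN sets_exceptional_box) auto

lemma emeasure_exceptional_box:
  assumes "\<iota> \<in> level_tuples d k \<eta>" "m \<in> grid k (\<iota> 1)"
  shows "emeasure (\<Pi>\<^sub>M j\<in>{2..d}. lborel) (exceptional_box d k m \<iota>)
    \<le> ennreal (\<Prod>j\<in>{2..d}. 144 * 4^\<iota> j / 4^k)"
proof -
  interpret product_sigma_finite "\<lambda>_::nat. lborel :: real measure"
    by (intro product_sigma_finite.intro lborel.sigma_finite_measure_axioms)
  have "emeasure (\<Pi>\<^sub>M j\<in>{2..d}. lborel) (exceptional_box d k m \<iota>)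
     = (\<Prod>j\<in>{2..d}. emeasure lborel {b\<in>{1..2}. 2 * b * (real m / 4^k) \<in> wide_arcs k (\<iota> j)})"
    unfolding exceptional_box_def by (intro emeasure_PiM wide_arcs_section_measurable) auto
  also have "\<dots> \<le> (\<Prod>j\<in>{2..d}. ennreal (144 * 4^\<iota> j / 4^k))"
  proof (rule prod_mono_ennreal)
    fix j assume "j \<in> {2..d}"
    then have "\<iota> j \<le> k" using assms(1) by (auto simp: level_tuples_def PiE_iff)
    then have "emeasure lborel {b\<in>{1..2}. 2 * b * (real m / 4^k) \<in> wide_arcs k (\<iota> j)}
        \<le> ennreal (120 * 4^\<iota> j / 4^k)"
      using grid_ge[OF assms(2)] by (rule emeasure_wide_arcs)
    \<comment> \<open>Raising 120 to the constant of \<open>card_grid_le\<close> lets all d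
      coordinates contribute factors of one shape.\<close>
    also have "\<dots> \<le> ennreal (144 * 4^\<iota> j / 4^k)"
      by (intro ennreal_leI divide_right_mono mult_right_mono) auto
    finally show "emeasure lborel {b\<in>{1..2}. 2 * b * (real m / 4^k) \<in> wide_arcs k (\<iota> j)}
        \<le> ennreal (144 * 4^\<iota> j / 4^k)" .
  qed
  also have "\<dots> = ennreal (\<Prod>j\<in>{2..d}. 144 * 4^\<iota> j / 4^k)" by (intro prod_ennreal) auto
  finally show ?thesis .
qed

text \<open>A union bound over level tuples and grid times. For one tuple, the number of times
  multiplied by the measure of a box is at most \<open>144^d\<close> times 4 to the power \<Sum>
  \<iota> j - k(d - 1), which is at most -\<eta> k by the choice of tuples. The number of tuples is
  polynomial in k.\<close>

lemma emeasure_exceptional_set: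
  assumes d: "d \<ge> 1"
  shows "emeasure (\<Pi>\<^sub>M j\<in>{2..d}. lborel) (exceptional_set d \<eta> k)
    \<le> ennreal (144^d * ((real k + 1)^d * (4 powr - \<eta>) ^ k))"
proof -
  let ?M = "\<Pi>\<^sub>M j\<in>{2..d}. lborel :: real measure"
  define c where "c = 144^d * (4 powr - \<eta>) ^ k"
  have inner: "emeasure ?M (\<Union>m\<in>grid k (\<iota> 1). exceptional_box d k m \<iota>) \<le> ennreal c"
    if \<iota>: "\<iota> \<in> level_tuples d k \<eta>" for \<iota>
  proof -
    define p where "p = (\<Prod>j\<in>{2..d}. 144 * 4^\<iota> j / 4^k :: real)"
    have p: "p \<ge> 0" unfolding p_def by (intro prod_nonneg) auto
    have i1: "\<iota> 1 \<le> k" using \<iota> d by (auto simp: level_tuples_def PiE_iff)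
    have "emeasure ?M (\<Union>m\<in>grid k (\<iota> 1). exceptional_box d k m \<iota>)
      \<le> (\<Sum>m\<in>grid k (\<iota> 1). emeasure ?M (exceptional_box d k m \<iota>))"
      by (intro emeasure_subadditive_finite) (auto intro: sets_exceptional_box)
    also have "\<dots> \<le> (\<Sum>m\<in>grid k (\<iota> 1). ennreal p)"
      unfolding p_def by (intro sum_mono emeasure_exceptional_box[OF \<iota>])
    also have "\<dots> = ennreal (real (card (grid k (\<iota> 1))) * p)"
      using p by (simp add: ennreal_mult' ennreal_of_nat_eq_real_of_nat)
    also have "\<dots> \<le> ennreal ((144 * 4^\<iota> 1) * p)"
      using p by (intro ennreal_leI mult_right_mono card_grid_le i1)
    \<comment> \<open>The number of times, divided by \<open>4^k\<close>, is the missing factor j =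
      1 of the product.\<close>
    also have "(144 * 4^\<iota> 1) * p = 4^k * (\<Prod>j\<in>{1..d}. 144 * 4^\<iota> j / 4^k)"
    proof -
      have "{1..d} = insert 1 {2..d}" using d by auto
      then show ?thesis unfolding p_def by simp
    qed
    also have "\<dots> = 144^d * 4 powr (real k + real (\<Sum>j=1..d. \<iota> j) - real k * real d)"
      by (simp add: prod_dividef prod.distrib powr_add powr_diff powr_realpow flip: power_sum power_mult of_nat_mult of_nat_sum)
    also have "\<dots> \<le> 144^d * 4 powr (- \<eta> * real k)"
    proof (intro mult_left_mono powr_mono)
      have "real (\<Sum>j=1..d. \<iota> j) \<le> real k * (real d - 1 - \<eta>)" using \<iota> by (auto simp: level_tuples_def)
      then show "real k + real (\<Sum>j=1..d. \<iota> j) - real k * real d \<le> - \<eta> * real k"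
        by (simp add: algebra_simps)
    qed auto
    also have "\<dots> = c" by (simp add: c_def powr_powr flip: powr_realpow)
    finally show ?thesis by (simp add: ennreal_leI)
  qed
  have c: "c \<ge> 0" by (simp add: c_def)
  have "emeasure ?M (exceptional_set d \<eta> k)
    \<le> (\<Sum>\<iota>\<in>level_tuples d k \<eta>. emeasure ?M (\<Union>m\<in>grid k (\<iota> 1). exceptional_box d k m \<iota>))"
    unfolding exceptional_set_def
    by (intro emeasure_subadditive_finite) (auto intro!: sets.finite_UN sets_exceptional_box)
  also have "\<dots> \<le> (\<Sum>\<iota>\<in>level_tuples d k \<eta>. ennreal c)" by (intro sum_mono inner)
  also have "\<dots> = ennreal (real (card (level_tuples d k \<eta>)) * c)"
    using c by (simp add: ennreal_mult' ennreal_of_nat_eq_real_of_nat)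
  also have "\<dots> \<le> ennreal ((real k + 1)^d * c)"
  proof (intro ennreal_leI mult_right_mono c)
    have "real (card (level_tuples d k \<eta>)) \<le> real ((k + 1) ^ d)"
      using card_level_tuples_le of_nat_le_iff by blast
    then show "real (card (level_tuples d k \<eta>)) \<le> (real k + 1)^d" by (simp add: add.commute)
  qed
  finally show ?thesis by (simp add: c_def mult_ac)
qed

text \<open>Exponential decay in k beats the polynomial number of level tuples, so the measures are
  summable and the Borel-Cantelli lemma applies.\<close>

lemma AE_eventually_not_exceptional:
  assumes d: "d \<ge> 1" and \<eta>: "\<eta> > 0"
  shows "AE \<beta> in (\<Pi>\<^sub>M j\<in>{2..d}. lborel). \<forall>\<^sub>F k in sequentially. \<beta> \<notin> exceptional_set d \<eta> k"
proof -
  let ?M = "\<Pi>\<^sub>M j\<in>{2..d}. lborel :: real measure"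
  let ?f = "\<lambda>k. 144^d * ((real k + 1)^d * (4 powr - \<eta>) ^ k)"
  have "summable (\<lambda>k. (real k + 1)^d * (4 powr - \<eta>) ^ k)"
  proof (rule summable_comparison_test_bigo)
    show "summable (\<lambda>k. norm (inverse (real k ^ 2)))"
      by (simp add: inverse_power_summable)
    show "(\<lambda>k. (real k + 1)^d * (4 powr - \<eta>)^k) \<in> O(\<lambda>k. inverse (real k ^ 2))"
      using \<eta> by real_asymp
  qed
  then have f: "summable ?f" by (rule summable_mult)
  have le: "emeasure ?M (exceptional_set d \<eta> k) \<le> ennreal (?f k)" for k
    by (rule emeasure_exceptional_set[OF d])
  have "AE \<beta> in ?M. \<forall>\<^sub>F k in sequentially. \<beta> \<in> space ?M - exceptional_set d \<eta> k"
  proof (rule borel_cantelli_AE1)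
    show "exceptional_set d \<eta> k \<in> sets ?M" for k by (rule sets_exceptional_set)
    show "emeasure ?M (exceptional_set d \<eta> k) < \<infinity>" for k
      using le by (rule le_less_trans) simp
    have "measure ?M (exceptional_set d \<eta> k) \<le> ?f k" for k
      unfolding measure_def using enn2real_mono[OF le] by simp
    then show "summable (\<lambda>k. measure ?M (exceptional_set d \<eta> k))"
      by (intro summable_comparison_test'[OF f, of 0]) auto
  qed
  then show ?thesis by (rule AE_mp) (auto elim: eventually_mono)
qed

section \<open>Factorisation of the sum and the bound for large times\<close>

definition speed :: "(nat \<Rightarrow> real) \<Rightarrow> nat \<Rightarrow> real" where
  "speed \<beta> j = (if j = 1 then 1 else \<beta> j)"

lemma quad_form_eq_sum_speed:
  assumes "d \<ge> 1"
  shows "quad_form d \<beta> n = (\<Sum>j=1..d. speed \<beta> j * (of_int (n j))\<^sup>2)"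
proof -
  have split: "{1..d} = insert 1 {2..d}" using assms by auto
  show ?thesis unfolding quad_form_def split by (simp add: speed_def)
qed

lemma exp_sum_eq_prod:
  assumes d: "d \<ge> 1"
  shows "exp_sum d \<beta> N x t = (\<Prod>j\<in>{1..d}. weyl_sum N (x j) (speed \<beta> j * t))"
proof -
  have cs: "cis (\<Sum>j\<in>A. f j) = (\<Prod>j\<in>A. cis (f j))" if "finite A" for A and f :: "nat \<Rightarrow> real"
    using that by (induction A) (simp_all flip: cis_mult)
  have "exp_sum d \<beta> N x t = (\<Sum>n\<in>lattice_cube d N. cis (2 * pi * ((\<Sum>i=1..d. x i * of_int (n i)) + t * quad_form d \<beta> n)))"
    unfolding exp_sum_def cis_conv_exp by (intro sum.cong refl) (simp add: mult_ac)
  also have "\<dots> = (\<Sum>n\<in>lattice_cube d N. \<Prod>j\<in>{1..d}. cis (2 * pi * (x j * of_int (n j) + speed \<beta> j * t * (of_int (n j))\<^sup>2)))"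
  proof (intro sum.cong refl)
    fix n
    have "2 * pi * ((\<Sum>i=1..d. x i * of_int (n i)) + t * quad_form d \<beta> n)
       = (\<Sum>j=1..d. 2 * pi * (x j * of_int (n j) + speed \<beta> j * t * (of_int (n j))\<^sup>2))"
      unfolding quad_form_eq_sum_speed[OF d] by (simp add: sum_distrib_left sum.distrib algebra_simps)
    then show "cis (2 * pi * ((\<Sum>i=1..d. x i * of_int (n i)) + t * quad_form d \<beta> n))
       = (\<Prod>j\<in>{1..d}. cis (2 * pi * (x j * of_int (n j) + speed \<beta> j * t * (of_int (n j))\<^sup>2)))"
      by (simp add: cs)
  qed
  also have "\<dots> = (\<Prod>j\<in>{1..d}. weyl_sum N (x j) (speed \<beta> j * t))"
    unfolding weyl_sum_def lattice_cube_def by (rule prod_sum_PiE[symmetric]) auto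
  finally show ?thesis .
qed

text \<open>The greatest level whose major arcs miss y; it exists because level 0 is empty. The Weyl
  bound applies at this level, while membership at the next one locates y near a fraction.\<close>

lemma exists_critical_level:
  obtains i where "i \<le> k" "y \<notin> major_arcs k i" "i < k \<Longrightarrow> y \<in> major_arcs k (Suc i)"
proof -
  have 0: "y \<notin> major_arcs k 0" by (auto simp: major_arcs_def)
  define i where "i = (GREATEST i. i \<le> k \<and> y \<notin> major_arcs k i)"
  have i: "i \<le> k \<and> y \<notin> major_arcs k i"
    unfolding i_def by (rule GreatestI_nat[where b = k]) (use 0 in auto)
  moreover have "y \<in> major_arcs k (Suc i)" if "i < k"
  proof (rule ccontr)
    assume "y \<notin> major_arcs k (Suc i)"
    then have "Suc i \<le> i" using that unfolding i_def by (intro Greatest_le_nat[where b = k]) auto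
    then show False by simp
  qed
  ultimately show ?thesis using that by blast
qed

text \<open>Every factor is bounded by the Weyl estimate at its critical level. After rounding t to
  the grid, the next levels place all factors in wide arcs simultaneously, so a small sum of levels
  would make \<beta> exceptional. A large sum of levels makes the product of the Weyl estimates as
  small as claimed.\<close>

lemma exp_sum_bound_large_time:
  assumes d: "d \<ge> 1" and \<beta>: "\<beta> \<in> space (\<Pi>\<^sub>M j\<in>{2..d}. lborel)" "\<And>j. j \<in> {2..d} \<Longrightarrow> \<beta> j \<in> {1..2}"
    and ex: "\<beta> \<notin> exceptional_set d \<eta> k"
    and t: "3 / 2^k \<le> t" "t \<le> 1" and N: "N \<le> 2^k"
  shows "(cmod (exp_sum d \<beta> N x t))\<^sup>2 \<le> (90 * (1 + real k))^d * 2 powr (real k * (real d + 1 + \<eta>))"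
proof -
  have "\<forall>j. \<exists>i. i \<le> k \<and> 2 * speed \<beta> j * t \<notin> major_arcs k i \<and>
      (i < k \<longrightarrow> 2 * speed \<beta> j * t \<in> major_arcs k (Suc i))"
    using exists_critical_level by metis
  then obtain lev where lev: "\<And>j. lev j \<le> k" "\<And>j. 2 * speed \<beta> j * t \<notin> major_arcs k (lev j)"
     "\<And>j. lev j < k \<Longrightarrow> 2 * speed \<beta> j * t \<in> major_arcs k (Suc (lev j))"
    by metis
  \<comment> \<open>Restriction puts the levels into the extensional product behind
    \<open>level_tuples\<close>; m is the time rounded down to a multiple of
    \<open>1 / 4^k\<close>.\<close>
  define \<iota> where "\<iota> = restrict lev {1..d}"
  define m where "m = nat \<lfloor>t * 4^k\<rfloor>"
  have "3 / 2^k * 4^k \<le> t * 4^k" using t by (intro mult_right_mono) auto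
  moreover have "3 / 2^k * 4^k = real (3 * 2^k)" by (simp add: field_simps flip: power_mult_distrib)
  ultimately have t1: "real (3 * 2^k) \<le> t * 4^k" by simp
  have t2: "t * 4^k \<le> 1 * 4^k" using t by (intro mult_right_mono) auto
  have m: "3 * 2^k \<le> m" unfolding m_def using t1 by (rule le_nat_floor)
  have "\<lfloor>t * 4^k\<rfloor> \<le> \<lfloor>1 * (4::real)^k\<rfloor>" using t2 by (rule floor_mono)
  then have "\<lfloor>t * 4^k\<rfloor> \<le> 4^k" using floor_of_int[of "4^k", where ?'a = real] by simp
  then have m2: "m \<le> 4^k" unfolding m_def by simp
  have "0 \<le> t * 4^k" using t1 by (rule order_trans[rotated]) simp
  then have "real m \<le> t * 4^k" "t * 4^k \<le> real m + 1"
    unfolding m_def by linarith+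
  then have "\<bar>t * 4^k - real m\<bar> \<le> 1" by linarith
  moreover have "t * 4^k - real m = (t - real m / 4^k) * 4^k" by (simp add: left_diff_distrib)
  ultimately have "\<bar>t - real m / 4^k\<bar> * 4^k \<le> 1" by (simp add: abs_mult)
  then have near: "\<bar>t - real m / 4^k\<bar> \<le> 1 / 4^k" by (simp add: pos_le_divide_eq)
  have sp: "1 \<le> speed \<beta> j" "speed \<beta> j \<le> 2" if "j \<in> {1..d}" for j
    using \<beta>(2)[of j] that by (auto simp: speed_def)
  have wide: "2 * speed \<beta> j * (real m / 4^k) \<in> wide_arcs k (lev j)" if j: "j \<in> {1..d}" for j
  proof (cases "lev j < k")
    case True
    have "\<bar>2 * speed \<beta> j * t - 2 * speed \<beta> j * (real m / 4^k)\<bar> = (2 * speed \<beta> j) * \<bar>t - real m / 4^k\<bar>"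
      using sp[OF j] by (simp only: abs_mult flip: right_diff_distrib)
    \<comment> \<open>The coefficients are at most 2, so rounding the time produces exactly the
      displacement that the wide arcs absorb.\<close>
    also have "\<dots> \<le> (2 * 2) * (1 / 4^k)" using sp[OF j] near by (intro mult_mono) auto
    finally show ?thesis using wide_arcs_near_major_arcs[OF lev(3)[OF True]] by simp
  qed (simp add: wide_arcs_def)
  have "\<not> real (\<Sum>j=1..d. \<iota> j) \<le> real k * (real d - 1 - \<eta>)"
  proof
    assume "real (\<Sum>j=1..d. \<iota> j) \<le> real k * (real d - 1 - \<eta>)"
    then have "\<iota> \<in> level_tuples d k \<eta>" using lev(1) by (auto simp: level_tuples_def \<iota>_def)
    moreover have "m \<in> grid k (\<iota> 1)"
      using wide[of 1] d m m2 by (auto simp: grid_def speed_def \<iota>_def)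
    moreover have "\<beta> \<in> exceptional_box d k m \<iota>"
      unfolding exceptional_box_def
    proof (rule PiE_I)
      fix j assume j: "j \<in> {2..d}"
      then show "\<beta> j \<in> {b\<in>{1..2}. 2 * b * (real m / 4^k) \<in> wide_arcs k (\<iota> j)}"
        using wide[of j] \<beta>(2)[OF j] by (auto simp: speed_def \<iota>_def)
    next
      fix j assume "j \<notin> {2..d}"
      then show "\<beta> j = undefined" using \<beta>(1) by (auto simp: space_PiM PiE_iff extensional_def)
    qed
    ultimately show False using ex unfolding exceptional_set_def by blast
  qed
  then have big: "real k * (real d - 1 - \<eta>) \<le> real (\<Sum>j=1..d. lev j)" by (simp add: \<iota>_def)
  have "(cmod (exp_sum d \<beta> N x t))\<^sup>2 = (\<Prod>j\<in>{1..d}. (cmod (weyl_sum N (x j) (speed \<beta> j * t)))\<^sup>2)"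
    by (simp add: exp_sum_eq_prod[OF d] prod_norm prod_power_distrib flip: prod_norm)
  also have "\<dots> \<le> (\<Prod>j\<in>{1..d}. 90 * (1 + real k) * (4^k / 2^lev j))"
  proof (intro prod_mono conjI)
    fix j
    show "(cmod (weyl_sum N (x j) (speed \<beta> j * t)))\<^sup>2 \<le> 90 * (1 + real k) * (4^k / 2^lev j)"
      by (rule weyl_sum_minor_arcs) (use lev N in \<open>auto simp: mult.assoc\<close>)
  qed auto
  also have "\<dots> = (90 * (1 + real k))^d * (\<Prod>j\<in>{1..d}. 4^k / 2^lev j)"
    by (subst prod.distrib) simp
  also have "(\<Prod>j\<in>{1..d}. 4^k / 2^lev j) = (2::real) powr (2 * real k * real d - real (\<Sum>j=1..d. lev j))"
  proof -
    have "(\<Prod>j\<in>{1..d}. 4^k / 2^lev j) = ((2::real)^(2*k))^d / 2^(\<Sum>j=1..d. lev j)"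
      by (simp add: prod_dividef power_sum power_mult)
    also have "\<dots> = 2 powr real (2*k*d) / 2 powr real (\<Sum>j=1..d. lev j)"
      by (simp add: powr_realpow flip: power_mult del: of_nat_mult of_nat_sum)
    also have "\<dots> = 2 powr (2 * real k * real d - real (\<Sum>j=1..d. lev j))" by (simp add: powr_diff)
    finally show ?thesis .
  qed
  also have "(90 * (1 + real k))^d * \<dots> \<le> (90 * (1 + real k))^d * 2 powr (real k * (real d + 1 + \<eta>))"
    using big by (intro mult_left_mono powr_mono) (auto simp: algebra_simps)
  finally show ?thesis .
qed

section \<open>Small times\<close>

definition torus_char :: "nat \<Rightarrow> (nat \<Rightarrow> int) \<Rightarrow> (nat \<Rightarrow> real) \<Rightarrow> complex" where
  "torus_char d n x = cis (2 * pi * (\<Sum>i=1..d. x i * of_int (n i)))"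

definition circle :: "real measure" where
  "circle = restrict_space lborel {0..<1}"

lemma emeasure_circle: "emeasure circle (space circle) = 1"
  by (simp add: circle_def emeasure_restrict_space space_restrict_space)

lemma finite_measure_circle: "finite_measure circle"
  by (rule finite_measureI) (simp add: emeasure_circle)

lemma integrable_circle_cis: "integrable circle (\<lambda>y. cis (2 * pi * (of_int k * y)))"
proof -
  interpret finite_measure circle by (rule finite_measure_circle)
  show ?thesis
  proof (rule integrable_const_bound[where B = 1])
    show "(\<lambda>y. cis (2 * pi * (of_int k * y))) \<in> borel_measurable circle"
      unfolding circle_def by (intro measurable_restrict_space1) (simp add: borel_measurable_continuous_onI continuous_intros)
  qed simp
qed

lemma has_vector_derivative_cis:
  "((\<lambda>t. cis (a * t)) has_vector_derivative of_real a * \<i> * cis (a * t)) (at t within S)"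
proof -
  have "((\<lambda>z. exp (\<i> * of_real a * z)) has_field_derivative of_real a * \<i> * exp (\<i> * of_real a * of_real t))
      (at (of_real t))"
    by (auto intro!: derivative_eq_intros)
  from has_vector_derivative_real_field[OF this] show ?thesis by (simp add: cis_conv_exp mult.assoc)
qed

lemma circle_orthogonality:
  "(LINT y|circle. cis (2 * pi * (of_int k * y))) = (if k = 0 then 1 else 0)"
proof (cases "k = 0")
  case True
  then show ?thesis
    by (simp add: measure_def emeasure_circle)
next
  case False
  let ?f = "\<lambda>y::real. cis (2 * pi * (of_int k * y))"
  let ?F = "\<lambda>y::real. cis (2 * pi * (of_int k * y)) / (2 * pi * of_int k * \<i>)"
  have [measurable]: "?f \<in> borel_measurable borel"
    by (intro borel_measurable_continuous_onI continuous_intros)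
  have "(LINT y|circle. ?f y) = (LINT y|lborel. indicator {0..<1} y *\<^sub>R ?f y)"
    unfolding circle_def by (subst integral_restrict_space) auto
  \<comment> \<open>Adding the endpoint, a null set, gives a closed interval for the fundamental
    theorem of calculus.\<close>
  also have "\<dots> = (LINT y|lborel. indicator {0..1} y *\<^sub>R ?f y)"
  proof (rule integral_cong_AE)
    show "AE y in lborel. indicator {0..<1} y *\<^sub>R ?f y = indicator {0..1} y *\<^sub>R ?f y"
      using AE_lborel_singleton[of 1] by eventually_elim (auto simp: indicator_def)
  qed auto
  also have "\<dots> = ?F 1 - ?F 0"
  proof (rule integral_FTC_Icc)
    fix y :: real
    have "(?F has_vector_derivative (of_real (2 * pi * of_int k) * \<i> * ?f y) / (2 * pi * of_int k * \<i>)) (at y within {0..1})"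
      using has_vector_derivative_cis[of "2 * pi * of_int k" y "{0..1}"]
      by (intro has_vector_derivative_divide) (simp add: mult.assoc)
    then show "(?F has_vector_derivative ?f y) (at y within {0..1})"
      using False by (simp add: scaleR_conv_of_real)
  qed (use False in \<open>auto intro!: continuous_intros\<close>)
  also have "?F 1 = ?F 0"
    using cis_multiple_2pi[of "of_int k"] by simp
  finally show ?thesis using False by simp
qed

text \<open>The integrand is a product of one-variable characters, so the integral factors over the
  circles. Extensionality guarantees that distinct n and m differ at a coordinate in {1..d}, where
  the factor vanishes.\<close>

lemma torus_char_orthogonality:
  assumes "n \<in> extensional {1..d}" "m \<in> extensional {1..d}"
  shows "integrable (torus d) (\<lambda>x. torus_char d n x * cnj (torus_char d m x))"
    and "(LINT x|torus d. torus_char d n x * cnj (torus_char d m x)) = (if n = m then 1 else 0)"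
proof -
  interpret finite_measure circle by (rule finite_measure_circle)
  interpret product_sigma_finite "\<lambda>_::nat. circle"
    by (intro product_sigma_finite.intro sigma_finite_measure_axioms)
  have cs: "cis (\<Sum>j\<in>A. f j) = (\<Prod>j\<in>A. cis (f j))" if "finite A" for A and f :: "nat \<Rightarrow> real"
    using that by (induction A) (simp_all flip: cis_mult)
  have eq: "(\<lambda>x. torus_char d n x * cnj (torus_char d m x))
     = (\<lambda>x. \<Prod>j\<in>{1..d}. cis (2 * pi * (of_int (n j - m j) * x j)))"
  proof
    fix x
    have "torus_char d n x * cnj (torus_char d m x)
      = cis (2 * pi * (\<Sum>i=1..d. x i * of_int (n i)) - 2 * pi * (\<Sum>i=1..d. x i * of_int (m i)))"
      unfolding torus_char_def cis_cnj cis_mult by simp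
    also have "2 * pi * (\<Sum>i=1..d. x i * of_int (n i)) - 2 * pi * (\<Sum>i=1..d. x i * of_int (m i))
      = (\<Sum>i=1..d. 2 * pi * (of_int (n i - m i) * x i))"
      by (simp add: sum_distrib_left flip: sum_subtractf) (simp add: algebra_simps)
    finally show "torus_char d n x * cnj (torus_char d m x) = (\<Prod>j\<in>{1..d}. cis (2 * pi * (of_int (n j - m j) * x j)))"
      by (simp add: cs)
  qed
  have T: "torus d = (\<Pi>\<^sub>M i\<in>{1..d}. circle)" by (simp add: torus_def circle_def)
  show "integrable (torus d) (\<lambda>x. torus_char d n x * cnj (torus_char d m x))"
    unfolding eq T by (intro product_integrable_prod integrable_circle_cis) auto
  have "(LINT x|torus d. torus_char d n x * cnj (torus_char d m x))
      = (\<Prod>j\<in>{1..d}. LINT y|circle. cis (2 * pi * (of_int (n j - m j) * y)))"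
    unfolding eq T by (intro product_integral_prod integrable_circle_cis) auto
  also have "\<dots> = (\<Prod>j\<in>{1..d}. if n j - m j = 0 then 1 else 0)"
    unfolding circle_orthogonality ..
  also have "\<dots> = (if n = m then 1 else 0)"
  proof (cases "n = m")
    case False
    then obtain j where "j \<in> {1..d}" "n j \<noteq> m j" using assms extensionalityI by blast
    then have "(\<Prod>j\<in>{1..d}. if n j - m j = 0 then 1 else (0::complex)) = 0"
      by (intro prod_zero) auto
    then show ?thesis using False by simp
  qed simp
  finally show "(LINT x|torus d. torus_char d n x * cnj (torus_char d m x)) = (if n = m then 1 else 0)" .
qed

text \<open>Parseval's identity: in the expanded square the off-diagonal terms integrate to zero.
  The nonnegative integral suits the later exchange with integration in time.\<close>

lemma nn_integral_torus_trig_poly: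
  assumes A: "finite A" "A \<subseteq> extensional {1..d}"
  shows "(\<integral>\<^sup>+x. ennreal ((cmod (\<Sum>n\<in>A. c n * torus_char d n x))\<^sup>2) \<partial>torus d)
    = ennreal (\<Sum>n\<in>A. (cmod (c n))\<^sup>2)"
proof -
  let ?f = "\<lambda>x. \<Sum>n\<in>A. c n * torus_char d n x"
  have eq: "complex_of_real ((cmod (?f x))\<^sup>2)
     = (\<Sum>n\<in>A. \<Sum>m\<in>A. c n * cnj (c m) * (torus_char d n x * cnj (torus_char d m x)))" for x
    by (simp only: complex_norm_square cnj_sum complex_cnj_mult sum_product) (simp add: mult_ac)
  have int: "integrable (torus d) (\<lambda>x. c n * cnj (c m) * (torus_char d n x * cnj (torus_char d m x)))"
    if "n \<in> A" "m \<in> A" for n m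
    using that A by (intro integrable_mult_right torus_char_orthogonality) auto
  have I: "integrable (torus d) (\<lambda>x. complex_of_real ((cmod (?f x))\<^sup>2))"
    unfolding eq by (intro Bochner_Integration.integrable_sum int)
  then have I': "integrable (torus d) (\<lambda>x. (cmod (?f x))\<^sup>2)"
    by (simp only: complex_of_real_integrable_eq)
  have "complex_of_real (LINT x|torus d. (cmod (?f x))\<^sup>2) = (LINT x|torus d. complex_of_real ((cmod (?f x))\<^sup>2))"
    by (rule integral_complex_of_real[symmetric])
  also have "\<dots> = (\<Sum>n\<in>A. \<Sum>m\<in>A. c n * cnj (c m) * (if n = m then 1 else 0))"
  proof -
    have "(LINT x|torus d. complex_of_real ((cmod (?f x))\<^sup>2))
      = (\<Sum>n\<in>A. \<Sum>m\<in>A. LINT x|torus d. c n * cnj (c m) * (torus_char d n x * cnj (torus_char d m x)))"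
      unfolding eq using int by (simp only: Bochner_Integration.integral_sum Bochner_Integration.integrable_sum cong: sum.cong)
    also have "\<dots> = (\<Sum>n\<in>A. \<Sum>m\<in>A. c n * cnj (c m) * (if n = m then 1 else 0))"
      using A by (intro sum.cong refl) (subst integral_mult_right_zero, subst torus_char_orthogonality(2), auto)
    finally show ?thesis .
  qed
  also have "\<dots> = (\<Sum>n\<in>A. c n * cnj (c n))"
    using A by (simp add: if_distrib cong: if_cong)
  also have "\<dots> = complex_of_real (\<Sum>n\<in>A. (cmod (c n))\<^sup>2)"
    by (simp only: of_real_sum complex_norm_square)
  finally have "(LINT x|torus d. (cmod (?f x))\<^sup>2) = (\<Sum>n\<in>A. (cmod (c n))\<^sup>2)"
    by (simp only: of_real_eq_iff)
  then show ?thesis using I' by (subst nn_integral_eq_integral) auto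
qed

text \<open>The derivative of |f|^2 is at most 2 |f| |f'|, hence at most L |f|^2 + |f'|^2 / L. The
  weight L, meant to be the size of the frequencies, balances the two terms. As the right-hand side
  does not depend on t, it controls the supremum over [0, T].\<close>

lemma sobolev_sup_bound:
  fixes f f' :: "real \<Rightarrow> complex"
  assumes deriv: "\<And>t. (f has_vector_derivative f' t) (at t)" and cont: "continuous_on UNIV f'"
    and t: "0 \<le> t" "t \<le> T" and L: "L > 0"
  shows "ennreal ((cmod (f t))\<^sup>2) \<le> ennreal ((cmod (f 0))\<^sup>2)
    + (\<integral>\<^sup>+s. ennreal (L * (cmod (f s))\<^sup>2 + (cmod (f' s))\<^sup>2 / L) * indicator {0..T} s \<partial>lborel)"
proof -
  define g where "g s = L * (cmod (f s))\<^sup>2 + (cmod (f' s))\<^sup>2 / L" for s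
  define h where "h s = 2 * (f s \<bullet> f' s)" for s
  have cf: "continuous_on UNIV f"
    using deriv by (intro continuous_at_imp_continuous_on ballI has_vector_derivative_continuous)
  have cg: "continuous_on UNIV g" and ch: "continuous_on UNIV h"
    unfolding g_def h_def using cf cont L by (auto intro!: continuous_intros)
  have hg: "h s \<le> g s" for s
  proof -
    have "h s \<le> 2 * (cmod (f s) * cmod (f' s))" unfolding h_def using norm_cauchy_schwarz[of "f s" "f' s"] by simp
    also have "\<dots> \<le> g s"
    proof -
      have "0 \<le> (L * cmod (f s) - cmod (f' s))\<^sup>2" by simp
      then have "2 * (cmod (f s) * cmod (f' s)) * L \<le> g s * L"
        unfolding g_def using L by (simp add: power2_eq_square algebra_simps)
      then show ?thesis using L by simp
    qed
    finally show ?thesis .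
  qed
  have g0: "0 \<le> g s" for s unfolding g_def using L by simp
  have ig: "integrable lborel (\<lambda>s. indicator {0..u} s *\<^sub>R g s)" for u
    using borel_integrable_compact[of "{0..u}" g] continuous_on_subset[OF cg] by simp
  have ih: "integrable lborel (\<lambda>s. indicator {0..u} s *\<^sub>R h s)" for u
    using borel_integrable_compact[of "{0..u}" h] continuous_on_subset[OF ch] by simp
  have "(LINT s|lborel. indicator {0..t} s *\<^sub>R h s) = (f t \<bullet> f t) - (f 0 \<bullet> f 0)"
  proof (rule integral_FTC_Icc[OF t(1)])
    fix s :: real
    have "((\<lambda>s. f s \<bullet> f s) has_vector_derivative (f s \<bullet> f' s + f' s \<bullet> f s)) (at s within {0..t})"
      using has_vector_derivative_at_within[OF deriv]
      by (intro bounded_bilinear.has_vector_derivative[OF bounded_bilinear_inner])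
    then show "((\<lambda>s. f s \<bullet> f s) has_vector_derivative h s) (at s within {0..t})"
      by (simp add: h_def inner_commute)
  qed (use continuous_on_subset[OF ch] in auto)
  then have "(cmod (f t))\<^sup>2 = (cmod (f 0))\<^sup>2 + (LINT s|lborel. indicator {0..t} s *\<^sub>R h s)"
    by (simp add: power2_norm_eq_inner)
  also have "(LINT s|lborel. indicator {0..t} s *\<^sub>R h s) \<le> (LINT s|lborel. indicator {0..T} s *\<^sub>R g s)"
  proof (rule integral_mono[OF ih ig])
    show "indicator {0..t} s *\<^sub>R h s \<le> indicator {0..T} s *\<^sub>R g s" for s
      using hg[of s] g0[of s] t by (auto simp: indicator_def)
  qed
  finally have "ennreal ((cmod (f t))\<^sup>2) \<le> ennreal ((cmod (f 0))\<^sup>2 + (LINT s|lborel. indicator {0..T} s *\<^sub>R g s))"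
    by (simp add: ennreal_leI)
  also have "\<dots> = ennreal ((cmod (f 0))\<^sup>2) + ennreal (LINT s|lborel. indicator {0..T} s *\<^sub>R g s)"
    using g0 by (intro ennreal_plus integral_nonneg_AE) auto
  also have "ennreal (LINT s|lborel. indicator {0..T} s *\<^sub>R g s) = (\<integral>\<^sup>+s. ennreal (indicator {0..T} s *\<^sub>R g s) \<partial>lborel)"
    using ig g0 by (intro nn_integral_eq_integral[symmetric]) auto
  also have "\<dots> = (\<integral>\<^sup>+s. ennreal (g s) * indicator {0..T} s \<partial>lborel)"
    by (intro nn_integral_cong) (auto simp: indicator_def)
  finally show ?thesis by (simp add: g_def)
qed

section \<open>Mean squares of the sum and of its time derivative\<close>

lemma finite_lattice_cube [simp]: "finite (lattice_cube d N)"
  unfolding lattice_cube_def by (intro finite_PiE) auto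

lemma card_lattice_cube: "card (lattice_cube d N) = (2 * N + 1) ^ d"
  unfolding lattice_cube_def by (simp add: card_PiE nat_add_distrib nat_mult_distrib)

lemma measurable_torus_coord: "i \<in> {1..d} \<Longrightarrow> (\<lambda>x. x i) \<in> borel_measurable (torus d)"
proof -
  assume "i \<in> {1..d}"
  then have "(\<lambda>x. x i) \<in> measurable (torus d) circle"
    unfolding torus_def circle_def by measurable
  moreover have "(\<lambda>y. y) \<in> borel_measurable circle"
    unfolding circle_def by (intro measurable_restrict_space1) simp
  ultimately show ?thesis by (rule measurable_compose)
qed

lemma measurable_torus_char [measurable]: "torus_char d n \<in> borel_measurable (torus d)"
proof -
  have "(\<lambda>x. \<Sum>i=1..d. x i * of_int (n i)) \<in> borel_measurable (torus d)"
    by (intro borel_measurable_sum borel_measurable_times measurable_torus_coord) auto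
  moreover have "(\<lambda>y. cis (2 * pi * y)) \<in> borel_measurable borel"
    by (intro borel_measurable_continuous_onI continuous_intros)
  ultimately show ?thesis unfolding torus_char_def by (rule measurable_compose)
qed

text \<open>General coefficients c are allowed so that the time derivative is again a sum of this
  form.\<close>

definition frequency_sum :: "nat \<Rightarrow> (nat \<Rightarrow> real) \<Rightarrow> nat \<Rightarrow> ((nat \<Rightarrow> int) \<Rightarrow> complex) \<Rightarrow> (nat \<Rightarrow> real) \<Rightarrow> real \<Rightarrow> complex" where
  "frequency_sum d \<beta> N c x t = (\<Sum>n\<in>lattice_cube d N. (c n * cis (2 * pi * quad_form d \<beta> n * t)) * torus_char d n x)"

lemma exp_sum_eq_frequency_sum: "exp_sum d \<beta> N x t = frequency_sum d \<beta> N (\<lambda>_. 1) x t"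
  unfolding exp_sum_def frequency_sum_def torus_char_def cis_mult mult_1
  by (intro sum.cong refl) (simp add: cis_conv_exp algebra_simps)

lemma measurable_frequency_sum [measurable]:
  "case_prod (frequency_sum d \<beta> N c) \<in> borel_measurable (torus d \<Otimes>\<^sub>M lborel)"
proof -
  have [measurable]: "(\<lambda>y. cis (2 * pi * q * y)) \<in> borel_measurable borel" for q
    by (intro borel_measurable_continuous_onI continuous_intros)
  have [measurable]: "(\<lambda>p. cis (2 * pi * q * snd p)) \<in> borel_measurable (torus d \<Otimes>\<^sub>M lborel)" for q
    by (rule measurable_compose[where N = borel]) measurable
  have [measurable]: "(\<lambda>p. torus_char d n (fst p)) \<in> borel_measurable (torus d \<Otimes>\<^sub>M lborel)" for n
    by measurable
  show ?thesis unfolding frequency_sum_def case_prod_beta by measurable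
qed

lemma nn_integral_frequency_sum:
  assumes "\<And>n. n \<in> lattice_cube d N \<Longrightarrow> cmod (c n) \<le> B"
  shows "(\<integral>\<^sup>+x. ennreal ((cmod (frequency_sum d \<beta> N c x t))\<^sup>2) \<partial>torus d)
    \<le> ennreal ((2 * real N + 1) ^ d * B\<^sup>2)"
proof -
  have "(\<integral>\<^sup>+x. ennreal ((cmod (frequency_sum d \<beta> N c x t))\<^sup>2) \<partial>torus d)
      = ennreal (\<Sum>n\<in>lattice_cube d N. (cmod (c n * cis (2 * pi * quad_form d \<beta> n * t)))\<^sup>2)"
    unfolding frequency_sum_def
  proof (rule nn_integral_torus_trig_poly[OF finite_lattice_cube])
    show "lattice_cube d N \<subseteq> extensional {1..d}" by (auto simp: lattice_cube_def PiE_iff)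
  qed
  also have "\<dots> \<le> ennreal (\<Sum>n\<in>lattice_cube d N. B\<^sup>2)"
    using assms by (intro ennreal_leI sum_mono power_mono) (auto simp: norm_mult)
  also have "\<dots> = ennreal ((2 * real N + 1) ^ d * B\<^sup>2)" by (simp add: card_lattice_cube add.commute)
  finally show ?thesis .
qed

lemma has_vector_derivative_frequency_sum:
  "(frequency_sum d \<beta> N c x has_vector_derivative
     frequency_sum d \<beta> N (\<lambda>n. c n * (2 * pi * quad_form d \<beta> n * \<i>)) x t) (at t)"
proof -
  have "((\<lambda>t. \<Sum>n\<in>lattice_cube d N. (c n * cis (2 * pi * quad_form d \<beta> n * t)) * torus_char d n x)
    has_vector_derivative (\<Sum>n\<in>lattice_cube d N.
      (c n * (of_real (2 * pi * quad_form d \<beta> n) * \<i> * cis (2 * pi * quad_form d \<beta> n * t))) * torus_char d n x)) (at t)"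
    by (intro has_vector_derivative_sum has_vector_derivative_mult_left has_vector_derivative_mult_right
        has_vector_derivative_cis)
  then show ?thesis unfolding frequency_sum_def[abs_def] by (simp add: mult.assoc)
qed

lemma continuous_frequency_sum: "continuous_on UNIV (frequency_sum d \<beta> N c x)"
  unfolding frequency_sum_def[abs_def] by (intro continuous_intros)

lemma sigma_finite_torus: "sigma_finite_measure (torus d)"
proof -
  interpret finite_measure "torus d" by standard (simp add: emeasure_torus)
  show ?thesis by (rule sigma_finite_measure_axioms)
qed

text \<open>H is the right-hand side of the Sobolev bound, a measurable majorant for all t in [0, T]
  at once. By Tonelli and Parseval, with K = \<open>(2 * N + 1) ^ d\<close>, the initial value
  contributes at most K and each time slice at most K (L + L^2 / L) = 2 L K.\<close>

lemma exp_sum_small_time: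
  assumes T: "T \<ge> 0" and L: "L > 0"
    and Q: "\<And>n. n \<in> lattice_cube d N \<Longrightarrow> 2 * pi * \<bar>quad_form d \<beta> n\<bar> \<le> L"
  obtains H where "H \<in> borel_measurable (torus d)"
    "\<And>x t. 0 \<le> t \<Longrightarrow> t \<le> T \<Longrightarrow> ennreal ((cmod (exp_sum d \<beta> N x t))\<^sup>2) \<le> H x"
    "(\<integral>\<^sup>+x. H x \<partial>torus d) \<le> ennreal ((2 * real N + 1) ^ d * (1 + 2 * L * T))"
proof -
  define f where "f = frequency_sum d \<beta> N (\<lambda>_. 1)"
  define f' where "f' = frequency_sum d \<beta> N (\<lambda>n. 1 * (2 * pi * quad_form d \<beta> n * \<i>))"
  define g where "g x s = ennreal (L * (cmod (f x s))\<^sup>2 + (cmod (f' x s))\<^sup>2 / L) * indicator {0..T} s" for x s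
  define H where "H x = ennreal ((cmod (f x 0))\<^sup>2) + (\<integral>\<^sup>+s. g x s \<partial>lborel)" for x
  define K where "K = (2 * real N + 1) ^ d"
  have K: "K \<ge> 0" by (simp add: K_def)
  interpret S: sigma_finite_measure "torus d" by (rule sigma_finite_torus)
  interpret P: pair_sigma_finite "torus d" lborel ..
  have [measurable]: "case_prod f \<in> borel_measurable (torus d \<Otimes>\<^sub>M lborel)"
    "case_prod f' \<in> borel_measurable (torus d \<Otimes>\<^sub>M lborel)"
    unfolding f_def f'_def by measurable
  have mfs: "(\<lambda>x. frequency_sum d \<beta> N c x s) \<in> borel_measurable (torus d)" for c s
    unfolding frequency_sum_def by measurable
  have [measurable]: "(\<lambda>x. f x s) \<in> borel_measurable (torus d)" "(\<lambda>x. f' x s) \<in> borel_measurable (torus d)" for s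
    unfolding f_def f'_def by (rule mfs)+
  have [measurable]: "case_prod g \<in> borel_measurable (torus d \<Otimes>\<^sub>M lborel)"
    unfolding g_def by measurable
  show ?thesis
  proof (rule that[of H])
    show "H \<in> borel_measurable (torus d)" unfolding H_def by measurable
    show "ennreal ((cmod (exp_sum d \<beta> N x t))\<^sup>2) \<le> H x" if "0 \<le> t" "t \<le> T" for x t
      unfolding exp_sum_eq_frequency_sum H_def g_def f_def f'_def
      by (intro sobolev_sup_bound has_vector_derivative_frequency_sum continuous_frequency_sum that L)
    have f2: "(\<integral>\<^sup>+x. ennreal ((cmod (f x s))\<^sup>2) \<partial>torus d) \<le> ennreal K" for s
      using nn_integral_frequency_sum[of d N "\<lambda>_. 1" 1 \<beta> s] by (simp add: f_def K_def)
    have f'2: "(\<integral>\<^sup>+x. ennreal ((cmod (f' x s))\<^sup>2) \<partial>torus d) \<le> ennreal (K * L\<^sup>2)" for s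
      unfolding f'_def K_def
      by (rule nn_integral_frequency_sum) (use Q in \<open>simp add: norm_mult abs_mult\<close>)
    have g1: "(\<integral>\<^sup>+x. g x s \<partial>torus d) \<le> ennreal (2 * L * K) * indicator {0..T} s" for s
    proof -
      have "(\<integral>\<^sup>+x. g x s \<partial>torus d)
        = (\<integral>\<^sup>+x. ennreal L * ennreal ((cmod (f x s))\<^sup>2) + ennreal (1 / L) * ennreal ((cmod (f' x s))\<^sup>2) \<partial>torus d)
           * indicator {0..T} s"
        unfolding g_def using L
        by (subst nn_integral_multc) (auto simp flip: ennreal_mult)
      also have "\<dots> = (ennreal L * (\<integral>\<^sup>+x. ennreal ((cmod (f x s))\<^sup>2) \<partial>torus d)
           + ennreal (1 / L) * (\<integral>\<^sup>+x. ennreal ((cmod (f' x s))\<^sup>2) \<partial>torus d)) * indicator {0..T} s"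
        by (subst nn_integral_add) (auto simp: nn_integral_cmult)
      also have "\<dots> \<le> (ennreal L * ennreal K + ennreal (1 / L) * ennreal (K * L\<^sup>2)) * indicator {0..T} s"
        by (intro mult_right_mono add_mono mult_left_mono f2 f'2) auto
      also have "ennreal L * ennreal K + ennreal (1 / L) * ennreal (K * L\<^sup>2) = ennreal (2 * L * K)"
        using L K by (simp add: power2_eq_square flip: ennreal_mult ennreal_plus)
      finally show ?thesis .
    qed
    have "(\<integral>\<^sup>+x. H x \<partial>torus d) = (\<integral>\<^sup>+x. ennreal ((cmod (f x 0))\<^sup>2) \<partial>torus d) + (\<integral>\<^sup>+x. \<integral>\<^sup>+s. g x s \<partial>lborel \<partial>torus d)"
      unfolding H_def by (rule nn_integral_add) measurable
    also have "(\<integral>\<^sup>+x. \<integral>\<^sup>+s. g x s \<partial>lborel \<partial>torus d) = (\<integral>\<^sup>+s. \<integral>\<^sup>+x. g x s \<partial>torus d \<partial>lborel)"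
      by (rule P.Fubini'[symmetric]) measurable
    also have "\<dots> \<le> (\<integral>\<^sup>+s. ennreal (2 * L * K) * indicator {0..T} s \<partial>lborel)"
      by (intro nn_integral_mono g1)
    also have "\<dots> = ennreal (2 * L * K) * ennreal T"
      using T by (simp add: nn_integral_cmult_indicator)
    also have "(\<integral>\<^sup>+x. ennreal ((cmod (f x 0))\<^sup>2) \<partial>torus d) + ennreal (2 * L * K) * ennreal T
      \<le> ennreal K + ennreal (2 * L * K) * ennreal T"
      by (intro add_right_mono f2)
    also have "\<dots> = ennreal (K * (1 + 2 * L * T))"
      using K L T by (simp add: algebra_simps flip: ennreal_mult ennreal_plus)
    finally show "(\<integral>\<^sup>+x. H x \<partial>torus d) \<le> ennreal ((2 * real N + 1) ^ d * (1 + 2 * L * T))"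
      by (simp add: K_def)
  qed
qed

section \<open>The maximal estimate\<close>

lemma quad_form_bound:
  assumes d: "d \<ge> 1" and \<beta>: "\<And>j. j \<in> {2..d} \<Longrightarrow> \<beta> j \<in> {1..2}" and n: "n \<in> lattice_cube d N"
  shows "\<bar>quad_form d \<beta> n\<bar> \<le> 2 * real d * (real N)\<^sup>2"
proof -
  have sp: "0 \<le> speed \<beta> j" "speed \<beta> j \<le> 2" if "j \<in> {1..d}" for j
    using \<beta>[of j] that by (auto simp: speed_def)
  have nj: "(real_of_int (n j))\<^sup>2 \<le> (real N)\<^sup>2" if "j \<in> {1..d}" for j
  proof -
    have "- int N \<le> n j" "n j \<le> int N" using n that by (auto simp: lattice_cube_def PiE_iff)
    then have "\<bar>real_of_int (n j)\<bar> \<le> real N" by linarith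
    then show ?thesis using abs_le_square_iff[of "real_of_int (n j)" "real N"] by simp
  qed
  have "\<bar>quad_form d \<beta> n\<bar> = quad_form d \<beta> n"
    unfolding quad_form_eq_sum_speed[OF d] by (intro abs_of_nonneg sum_nonneg mult_nonneg_nonneg sp) auto
  also have "\<dots> \<le> (\<Sum>j=1..d. 2 * (real N)\<^sup>2)"
    unfolding quad_form_eq_sum_speed[OF d] by (intro sum_mono mult_mono sp nj) auto
  finally show ?thesis by (simp add: mult_ac)
qed

lemma maximal_sum_square_le:
  assumes "\<And>t. 0 < t \<Longrightarrow> t < 1 \<Longrightarrow> (cmod (exp_sum d \<beta> N x t))\<^sup>2 \<le> K"
  shows "(maximal_sum d \<beta> N x)\<^sup>2 \<le> K"
proof -
  have "(cmod (exp_sum d \<beta> N x (1/2)))\<^sup>2 \<le> K" by (rule assms) auto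
  then have K: "0 \<le> K" by (rule order_trans[rotated]) simp
  have "maximal_sum d \<beta> N x \<le> sqrt K"
    unfolding maximal_sum_def by (intro cSUP_least) (auto intro: real_le_rsqrt assms)
  then have "(maximal_sum d \<beta> N x)\<^sup>2 \<le> (sqrt K)\<^sup>2" by (intro power_mono maximal_sum_nonneg)
  then show ?thesis using K by simp
qed

text \<open>The squared maximal function is dominated by B + H, with B the uniform bound for large
  times and H the majorant for small ones. The torus has measure 1, so B integrates to itself, and H
  contributes order M^(d + 1) because L * T is of order M.\<close>

lemma integral_maximal_sum_square_le:
  assumes d: "d \<ge> 1" and \<beta>: "\<beta> \<in> space (\<Pi>\<^sub>M j\<in>{2..d}. lborel)" "\<And>j. j \<in> {2..d} \<Longrightarrow> \<beta> j \<in> {1..2}"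
    and ex: "\<beta> \<notin> exceptional_set d \<eta> k" and \<eta>: "\<eta> \<ge> 0" and N: "N \<le> 2^k"
  shows "(LINT x|torus d. (maximal_sum d \<beta> N x)\<^sup>2)
    \<le> (90 ^ d + 3 ^ d * (1 + 24 * pi * real d)) * (1 + real k)^d * 2 powr (real k * (real d + 1 + \<eta>))"
proof -
  define M :: real where "M = 2^k"
  have M: "M \<ge> 1" by (simp add: M_def)
  have NM: "real N \<le> M" using of_nat_mono[OF N, where ?'a = real] by (simp add: M_def)
  define P where "P = 2 powr (real k * (real d + 1 + \<eta>))"
  define B where "B = (90 * (1 + real k))^d * P"
  \<comment> \<open>T is the time from which the large-time bound is available; L below is 2 pi
    times the bound 2 d M^2 for the quadratic form.\<close>
  define T where "T = 3 / M"
  define L where "L = 4 * pi * real d * M\<^sup>2"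
  have L: "L > 0" unfolding L_def using d M by simp
  have T: "T \<ge> 0" unfolding T_def using M by simp
  have B: "B \<ge> 0" by (simp add: B_def P_def)
  have Q: "2 * pi * \<bar>quad_form d \<beta> n\<bar> \<le> L" if "n \<in> lattice_cube d N" for n
  proof -
    have "\<bar>quad_form d \<beta> n\<bar> \<le> 2 * real d * (real N)\<^sup>2" by (rule quad_form_bound[OF d \<beta>(2) that])
    also have "\<dots> \<le> 2 * real d * M\<^sup>2" using NM by (intro mult_left_mono power_mono) auto
    finally have "2 * pi * \<bar>quad_form d \<beta> n\<bar> \<le> 2 * pi * (2 * real d * M\<^sup>2)" by (intro mult_left_mono) auto
    then show ?thesis by (simp add: L_def)
  qed
  obtain H where H: "H \<in> borel_measurable (torus d)"
    "\<And>x t. 0 \<le> t \<Longrightarrow> t \<le> T \<Longrightarrow> ennreal ((cmod (exp_sum d \<beta> N x t))\<^sup>2) \<le> H x"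
    "(\<integral>\<^sup>+x. H x \<partial>torus d) \<le> ennreal ((2 * real N + 1) ^ d * (1 + 2 * L * T))"
    using exp_sum_small_time[OF T L Q] by blast
  note [measurable] = H(1)
  have pt: "ennreal ((maximal_sum d \<beta> N x)\<^sup>2) \<le> ennreal B + H x" for x
  proof (cases "H x")
    case (real h)
    have "(cmod (exp_sum d \<beta> N x t))\<^sup>2 \<le> B + h" if "0 < t" "t < 1" for t
    proof (cases "t \<le> T")
      case True
      then have "ennreal ((cmod (exp_sum d \<beta> N x t))\<^sup>2) \<le> ennreal h" using H(2)[of t x] that real by simp
      then show ?thesis using real B by simp
    next
      case False
      have "(cmod (exp_sum d \<beta> N x t))\<^sup>2 \<le> B"
        unfolding B_def P_def
        by (rule exp_sum_bound_large_time[OF d \<beta> ex]) (use False that N in \<open>auto simp: T_def M_def\<close>)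
      then show ?thesis using real by simp
    qed
    then have "(maximal_sum d \<beta> N x)\<^sup>2 \<le> B + h" by (rule maximal_sum_square_le)
    then have "ennreal ((maximal_sum d \<beta> N x)\<^sup>2) \<le> ennreal (B + h)" by (rule ennreal_leI)
    then show ?thesis using real B by simp
  qed simp
  have "ennreal (LINT x|torus d. (maximal_sum d \<beta> N x)\<^sup>2) = (\<integral>\<^sup>+x. ennreal ((maximal_sum d \<beta> N x)\<^sup>2) \<partial>torus d)"
    by (rule nn_integral_eq_integral[OF integrable_maximal_sum_square, symmetric]) simp
  also have "\<dots> \<le> (\<integral>\<^sup>+x. ennreal B + H x \<partial>torus d)" by (intro nn_integral_mono pt)
  also have "\<dots> = ennreal B + (\<integral>\<^sup>+x. H x \<partial>torus d)"
    by (subst nn_integral_add) (simp_all add: emeasure_torus)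
  also have "\<dots> \<le> ennreal B + ennreal ((2 * real N + 1) ^ d * (1 + 2 * L * T))" by (intro add_left_mono H)
  also have "\<dots> = ennreal (B + (2 * real N + 1) ^ d * (1 + 2 * L * T))"
    using B L T by (intro ennreal_plus[symmetric]) auto
  finally have "(LINT x|torus d. (maximal_sum d \<beta> N x)\<^sup>2) \<le> B + (2 * real N + 1) ^ d * (1 + 2 * L * T)"
    using B L T by (subst (asm) ennreal_le_iff) auto
  also have "\<dots> \<le> B + (3 ^ d * (1 + 24 * pi * real d)) * (1 + real k)^d * P"
  proof (intro add_left_mono)
    have "(2 * real N + 1) ^ d * (1 + 2 * L * T) \<le> (3 * M) ^ d * ((1 + 24 * pi * real d) * M)"
    proof (intro mult_mono power_mono)
      have "2 * L * T = 24 * pi * real d * M" using M by (simp add: L_def T_def power2_eq_square)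
      then show "1 + 2 * L * T \<le> (1 + 24 * pi * real d) * M" using M by (simp add: algebra_simps)
    qed (use NM M L T in auto)
    also have "\<dots> = 3 ^ d * (1 + 24 * pi * real d) * 1 * M ^ (d + 1)" by (simp add: power_mult_distrib)
    also have "\<dots> \<le> 3 ^ d * (1 + 24 * pi * real d) * (1 + real k)^d * P"
    proof (intro mult_mono)
      have "M ^ (d + 1) = 2 powr (real k * (real d + 1))"
      proof -
        have "M ^ (d + 1) = M powr real (d + 1)" using M by (intro powr_realpow[symmetric]) simp
        also have "M powr real (d + 1) = (2 powr real k) powr real (d + 1)"
          by (simp only: M_def powr_realpow zero_less_numeral)
        finally show ?thesis by (simp only: powr_powr of_nat_add of_nat_1)
      qed
      also have "\<dots> \<le> P" unfolding P_def using \<eta> by (intro powr_mono mult_left_mono) auto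
      finally show "M ^ (d + 1) \<le> P" .
    qed (use M in auto)
    finally show "(2 * real N + 1) ^ d * (1 + 2 * L * T) \<le> 3 ^ d * (1 + 24 * pi * real d) * (1 + real k)^d * P" .
  qed
  also have "\<dots> = (90 ^ d + 3 ^ d * (1 + 24 * pi * real d)) * (1 + real k)^d * P"
    by (simp only: B_def power_mult_distrib distrib_right)
  finally show ?thesis by (simp add: P_def)
qed

section \<open>From dyadic scales to all N\<close>

lemma exists_dyadic_scale:
  assumes "N \<ge> (1::nat)"
  obtains k where "N \<le> 2^k" "2^k \<le> 2 * N"
proof (cases "N = 1")
  case True
  then show ?thesis using that[of 0] by simp
next
  case False
  then obtain k where "2^k < N" "N \<le> 2^(k+1)" using ex_power_ivl2[of 2 N] assms by auto
  then show ?thesis using that[of "k+1"] by simp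
qed

lemma polynomial_le_exponential:
  assumes "\<epsilon> > (0::real)"
  obtains C where "C > 0" "\<And>k::nat. (1 + real k)^d \<le> C * 2 powr (\<epsilon> * real k)"
proof -
  have "(\<lambda>k::nat. (1 + real k)^d * 2 powr (- \<epsilon> * real k)) \<longlonglongrightarrow> 0" using assms by real_asymp
  then have "Bseq (\<lambda>k::nat. (1 + real k)^d * 2 powr (- \<epsilon> * real k))"
    by (intro convergent_imp_Bseq) (auto simp: convergent_def)
  then obtain C where C: "C > 0" "\<And>k::nat. norm ((1 + real k)^d * 2 powr (- \<epsilon> * real k)) \<le> C"
    by (auto simp: Bseq_def)
  have "(1 + real k)^d \<le> C * 2 powr (\<epsilon> * real k)" for k
    using C(2)[of k] by (simp add: powr_minus field_simps)
  then show ?thesis using that C(1) by blast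
qed

text \<open>For the squared norm, one \<epsilon> absorbs the polynomial factor in k and another
  covers \<eta>. The exponent d + 1 + 2 \<epsilon> is halved by the square root.\<close>

lemma L2_maximal_sum_eventual_bound:
  assumes d: "d \<ge> 1" and \<beta>: "\<beta> \<in> space (\<Pi>\<^sub>M j\<in>{2..d}. lborel)" "\<And>j. j \<in> {2..d} \<Longrightarrow> \<beta> j \<in> {1..2}"
    and \<eta>: "0 \<le> \<eta>" "\<eta> \<le> \<epsilon>" and \<epsilon>: "\<epsilon> > 0"
    and ex: "\<forall>k\<ge>k0. \<beta> \<notin> exceptional_set d \<eta> k"
  obtains C where "\<And>N. N \<ge> 2^k0 \<Longrightarrow>
    L2_norm_on (torus d) (maximal_sum d \<beta> N) \<le> C * real N powr ((real d + 1) / 2 + \<epsilon>)"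
proof -
  define A where "A = 90 ^ d + 3 ^ d * (1 + 24 * pi * real d)"
  have A: "A \<ge> 0" by (simp add: A_def)
  obtain K where K: "K > 0" "\<And>k::nat. (1 + real k)^d \<le> K * 2 powr (\<epsilon> * real k)"
    using polynomial_le_exponential[OF \<epsilon>] by blast
  define p where "p = real d + 1 + 2 * \<epsilon>"
  have p: "p \<ge> 0" using \<epsilon> by (simp add: p_def)
  show ?thesis
  proof (rule that)
    fix N :: nat assume N: "N \<ge> 2^k0"
    then have N1: "N \<ge> 1" by (rule order_trans[rotated]) simp
    obtain k where k: "N \<le> 2^k" "2^k \<le> 2 * N" using exists_dyadic_scale[OF N1] .
    have "(2::nat)^k0 \<le> 2^k" using N k by linarith
    then have "k0 \<le> k" by simp
    then have exk: "\<beta> \<notin> exceptional_set d \<eta> k" using ex by blast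
    have two_k: "2 powr real k \<le> 2 * real N" using of_nat_mono[OF k(2), where ?'a = real] by (simp add: powr_realpow)
    have "(LINT x|torus d. (maximal_sum d \<beta> N x)\<^sup>2) \<le> A * (1 + real k)^d * 2 powr (real k * (real d + 1 + \<eta>))"
      unfolding A_def by (rule integral_maximal_sum_square_le[OF d \<beta> exk \<eta>(1) k(1)])
    also have "\<dots> \<le> A * (K * 2 powr (\<epsilon> * real k)) * 2 powr (real k * (real d + 1 + \<epsilon>))"
      using \<eta> A K by (intro mult_mono mult_left_mono powr_mono) auto
    also have "\<dots> = A * K * (2 powr (\<epsilon> * real k) * 2 powr (real k * (real d + 1 + \<epsilon>)))" by simp
    also have "2 powr (\<epsilon> * real k) * 2 powr (real k * (real d + 1 + \<epsilon>)) = (2 powr real k) powr p"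
      unfolding powr_powr p_def by (simp add: algebra_simps flip: powr_add)
    also have "A * K * \<dots> \<le> A * K * (2 * real N) powr p"
      using two_k p A K by (intro mult_left_mono powr_mono2) auto
    also have "\<dots> = (A * K * 2 powr p) * real N powr p" by (simp add: powr_mult)
    finally have "L2_norm_on (torus d) (maximal_sum d \<beta> N) \<le> sqrt ((A * K * 2 powr p) * real N powr p)"
      unfolding L2_norm_on_def by simp
    also have "\<dots> = sqrt (A * K * 2 powr p) * real N powr (p / 2)"
      using N1 by (simp add: real_sqrt_mult powr_half_sqrt_powr)
    also have "p / 2 = (real d + 1) / 2 + \<epsilon>" by (simp add: p_def field_simps)
    finally show "L2_norm_on (torus d) (maximal_sum d \<beta> N)
      \<le> sqrt (A * K * 2 powr p) * real N powr ((real d + 1) / 2 + \<epsilon>)" .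
  qed
qed

lemma L2_maximal_sum_bound:
  assumes d: "d \<ge> 1" and \<beta>: "\<beta> \<in> space (\<Pi>\<^sub>M j\<in>{2..d}. lborel)" "\<And>j. j \<in> {2..d} \<Longrightarrow> \<beta> j \<in> {1..2}"
    and \<eta>: "0 \<le> \<eta>" "\<eta> \<le> \<epsilon>" and \<epsilon>: "\<epsilon> > 0"
    and ex: "\<forall>\<^sub>F k in sequentially. \<beta> \<notin> exceptional_set d \<eta> k"
  shows "\<exists>C. \<forall>N\<ge>1. L2_norm_on (torus d) (maximal_sum d \<beta> N) \<le> C * real N powr ((real d + 1) / 2 + \<epsilon>)"
proof -
  let ?n = "\<lambda>N. L2_norm_on (torus d) (maximal_sum d \<beta> N)"
  let ?e = "(real d + 1) / 2 + \<epsilon>"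
  obtain k0 where k0: "\<forall>k\<ge>k0. \<beta> \<notin> exceptional_set d \<eta> k"
    using ex by (auto simp: eventually_sequentially)
  obtain C where C: "\<And>N. N \<ge> 2^k0 \<Longrightarrow> ?n N \<le> C * real N powr ?e"
    using L2_maximal_sum_eventual_bound[OF d \<beta> \<eta> \<epsilon> k0] by blast
  have n0: "0 \<le> ?n N" for N by (simp add: L2_norm_on_def)
  \<comment> \<open>S takes care of the finitely many N below \<open>2^k0\<close>, since the power
    of N is at least 1; C may be negative, hence its absolute value.\<close>
  define S where "S = (\<Sum>N<2^k0. ?n N)"
  have S0: "0 \<le> S" unfolding S_def using n0 by (intro sum_nonneg) auto
  have "?n N \<le> (\<bar>C\<bar> + S) * real N powr ?e" if N: "N \<ge> 1" for N
  proof (cases "N < 2^k0")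
    case True
    have "?n N \<le> S" unfolding S_def using True n0 by (intro member_le_sum) auto
    also have "\<dots> \<le> (\<bar>C\<bar> + S) * 1" by simp
    also have "\<dots> \<le> (\<bar>C\<bar> + S) * real N powr ?e"
      using S0 N \<epsilon> by (intro mult_left_mono ge_one_powr_ge_zero) auto
    finally show ?thesis .
  next
    case False
    then have "?n N \<le> C * real N powr ?e" by (intro C) simp
    also have "\<dots> \<le> (\<bar>C\<bar> + S) * real N powr ?e" using S0 by (intro mult_right_mono) auto
    finally show ?thesis .
  qed
  then show ?thesis by blast
qed

theorem theorem1p6:
  fixes d :: nat
  assumes "d \<ge> 2"
  shows "AE \<beta> in (\<Pi>\<^sub>M i\<in>{2..d}. lborel).
    (\<forall>i\<in>{2..d}. \<beta> i \<in> {1..2}) \<longrightarrow>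
    (\<forall>\<epsilon>>0. \<exists>C::real. \<forall>N::nat. N \<ge> 1 \<longrightarrow>
      L2_norm_on (torus d) (maximal_sum d \<beta> N)
        \<le> C * real N powr ((real d + 1) / 2 + \<epsilon>))"
proof -
  let ?M = "\<Pi>\<^sub>M i\<in>{2..d}. lborel :: real measure"
  have d: "d \<ge> 1" using assms by simp
  \<comment> \<open>The null set must not depend on \<epsilon>, so \<eta> runs through the countable
    sequence 1/(r + 1), and each \<epsilon> later picks a member below it.\<close>
  have "AE \<beta> in ?M. \<forall>r::nat. \<forall>\<^sub>F k in sequentially. \<beta> \<notin> exceptional_set d (1 / real (Suc r)) k"
    unfolding AE_all_countable by (intro allI AE_eventually_not_exceptional d) simp
  \<comment> \<open>Membership in the space makes \<beta> extensional on {2..d}, as elements of the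
    exceptional boxes are.\<close>
  with AE_space[of ?M] show ?thesis
  proof eventually_elim
    case (elim \<beta>)
    show ?case
    proof (intro impI allI)
      fix \<epsilon> :: real assume \<beta>: "\<forall>i\<in>{2..d}. \<beta> i \<in> {1..2}" and \<epsilon>: "0 < \<epsilon>"
      obtain r where "inverse (real (Suc r)) < \<epsilon>" using reals_Archimedean[OF \<epsilon>] by auto
      then have r: "1 / real (Suc r) \<le> \<epsilon>" by (simp add: inverse_eq_divide)
      show "\<exists>C. \<forall>N\<ge>1. L2_norm_on (torus d) (maximal_sum d \<beta> N) \<le> C * real N powr ((real d + 1) / 2 + \<epsilon>)"
        by (rule L2_maximal_sum_bound[OF d elim(1) _ _ r \<epsilon>]) (use \<beta> elim(2) in auto)
    qed
  qed
qed

end
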